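(* Let $(A,\mathbf{b})\in\mathbb{C}^{m\times n}\times\mathbb{C}^m$. The following hold, where $A\neq O$ is assumed in (i) and (iii). (i) $\mathrm{sol}(A,\mathbf{b})=\mathrm{sol}_\theta(A,\mathbf{b})$ for all $0<\theta<\|A^\dagger\|_2^{-1}$ if $\mathbf{b}\in\mathrm{range}(A)$, and for all $0<\theta<\min\{\|A^\dagger\|_2^{-1},\ \|\mathbf{b}-AA^\dagger\mathbf{b}\|_2\}$ otherwise. (ii) Assume the set $\mathrm{sol}_\theta(A,\mathbf{b})$ is well-defined within a certain $\theta>0$. There is a $\xi>0$ depending on $A$, $\mathbf{b}$ and $\theta$ such that, for every $(\Delta A,\Delta\mathbf{b})\in\mathbb{C}^{m\times n}\times\mathbb{C}^m$ with a sufficiently small norm, there exists a unique $\mathrm{sol}_\theta(A+\Delta A,\mathbf{b}+\Delta\mathbf{b})$ satisfying $$\mathrm{dist}\big(\mathrm{sol}_\theta(A+\Delta A,\mathbf{b}+\Delta\mathbf{b}),\,\mathrm{sol}_\theta(A,\mathbf{b})\big)\le\xi\,\|(\Delta A,\Delta\mathbf{b})\|.$$ (iii)(a) Assume $\mathbf{b}\in\mathrm{range}(A)$ and let $\mathbf{x}_*=A^\dagger\mathbf{b}$ and $\omega=\sqrt{4\|A^\dagger\|_2^2\|\mathbf{b}\|_2^2+2}$. For any $(\tilde A,\tilde{\mathbf{b}})=(A+\Delta A,\mathbf{b}+\Delta\mathbf{b})$ satisfying $\|(\Delta A,\Delta\mathbf{b})\|<\big((\omega+1)\|A^\dagger\|_2\big)^{-1}$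 and any $\theta$ satisfying $$\omega\,\|(\Delta A,\Delta\mathbf{b})\|<\theta<\|A^\dagger\|_2^{-1}-\|(\Delta A,\Delta\mathbf{b})\|,$$ there exists a unique general numerical solution $\mathrm{sol}_\theta(\tilde A,\tilde{\mathbf{b}})$, with the backward error bound $\|(\tilde A,\tilde{\mathbf{b}})-(\tilde A_\theta,\tilde{\mathbf{b}}_\theta)\|\le\omega\,\|(\Delta A,\Delta\mathbf{b})\|$ and the forward error bound $$\mathrm{dist}\big(\mathrm{sol}_\theta(\tilde A,\tilde{\mathbf{b}}),\,\mathrm{sol}(A,\mathbf{b})\big)\le\|A\|_2\,\|A^\dagger\|_2\,\frac{\sqrt{4\|\mathbf{x}_*\|_2^2+1}}{\|A\|_2-\|A\|_2\,\|A^\dagger\|_2\,\|\Delta A\|_2}\,\|(\Delta A,\Delta\mathbf{b})\|.$$ (iii)(b) Assume $\mathrm{sol}(A,\mathbf{b})=\emptyset$. For any $\theta$ with $0<\theta<\min\{\frac12\|A^\dagger\|_2^{-1},\ \|\mathbf{b}-AA^\dagger\mathbf{b}\|_2\}$, there is a constant $\rho\in(0,\theta)$ such that $\mathrm{sol}_\theta(\tilde A,\tilde{\mathbf{b}})=\mathrm{sol}(A,\mathbf{b})=\emptyset$ for every $(\tilde A,\tilde{\mathbf{b}})\in\mathbb{C}^{m\times n}\times\mathbb{C}^m$ satisfying $\|(\tilde A,\tilde{\mathbf{b}})-(A,\mathbf{b})\|<\rho$.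
   Context: For $G\in\mathbb{C}^{m\times n}$, $\sigma_j(G)$ is the $j$-th largest singular value, $\|G\|_2$ the spectral norm, $G^\dagger$ the Moore-Penrose inverse; for $G\neq O$, $\|G^\dagger\|_2^{-1}$ is the smallest positive singular value of $G$. With a singular value decomposition $G=\sum_j\sigma_j(G)\mathbf{u}_j\mathbf{v}_j^{H}$ and $\theta>0$ not a singular value of $G$, the $\theta$-projection is $G_\theta=\sum_{\sigma_j(G)>\theta}\sigma_j(G)\mathbf{u}_j\mathbf{v}_j^{H}$ (undefined if $\theta$ is a singular value of $G$). For $\mathbf{d}\in\mathbb{C}^m$, $\mathbf{d}_\theta:=G_\theta G_\theta^\dagger\mathbf{d}$ is the orthogonal projection of $\mathbf{d}$ onto $\mathrm{range}(G_\theta)$. The norm on $\mathbb{C}^{m\times n}\times\mathbb{C}^m$ is $\|(G,\mathbf{d})\|:=\sqrt{\|G\|_2^2+\|\mathbf{d}\|_2^2}$. $\mathrm{sol}(G,\mathbf{d}):=\{\mathbf{u}\in\mathbb{C}^n:G\mathbf{u}=\mathbf{d}\}$. The general numerical solution of $G\mathbf{x}=\mathbf{d}$ within $\theta$ is $\mathrm{sol}_\theta(G,\mathbf{d}):=\mathrm{sol}(G_\theta,\mathbf{d}_\theta)$ if $\|(G,\mathbf{d})-(G_\theta,\mathbf{d}_\theta)\|<\theta$, and $\mathrm{sol}_\theta(G,\mathbf{d}):=\emptyset$ if $\|(G,\mathbf{d})-(G_\theta,\mathbf{d}_\theta)\|>\theta$. It is undefined if $\theta$ is a singular value of $G$ or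 $\theta=\|(G,\mathbf{d})-(G_\theta,\mathbf{d}_\theta)\|$; otherwise it is well-defined. Existence and uniqueness of $\mathrm{sol}_\theta$ means that it is well-defined. For subspaces $\mathcal{P},\mathcal{Q}$ of $\mathbb{C}^n$ of equal dimension, $\mathrm{dist}(\mathcal{P},\mathcal{Q})=\|PP^{H}-QQ^{H}\|_2$, where the columns of $P,Q$ form orthonormal bases of $\mathcal{P},\mathcal{Q}$. For affine subspaces of equal dimension, $\mathrm{dist}(\mathbf{u}_1+\mathcal{V}_1,\mathbf{u}_2+\mathcal{V}_2)=\max\{\|\hat{\mathbf{u}}_1-\hat{\mathbf{u}}_2\|_2,\mathrm{dist}(\mathcal{V}_1,\mathcal{V}_2)\}$, where $\hat{\mathbf{u}}_j$ is the unique (minimum norm) element of $\mathcal{V}_j^\perp\cap(\mathbf{u}_j+\mathcal{V}_j)$; also $\mathrm{dist}(\emptyset,\emptyset)=0$. The distance is defined only between affine subspaces of the same dimension or two empty sets, so an inequality for $\mathrm{dist}$ includes the assertion that both sets are affine subspaces of the same dimension or both are empty. *)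

theory Defs
  imports "HOL-Analysis.Analysis"
begin

definition hinner :: "complex^'n \<Rightarrow> complex^'n \<Rightarrow> complex" where
  "hinner x y = (\<Sum>i\<in>UNIV. x $ i * cnj (y $ i))"

definition hadjoint :: "complex^'n^'m \<Rightarrow> complex^'m^'n" where
  "hadjoint G = (\<chi> i j. cnj (G $ j $ i))"

text \<open>The matrix $x y^H$.\<close>

definition outer :: "complex^'m \<Rightarrow> complex^'n \<Rightarrow> complex^'n^'m" where
  "outer x y = (\<chi> i j. x $ i * cnj (y $ j))"

definition orthonormal_fam :: "nat \<Rightarrow> (nat \<Rightarrow> complex^'n) \<Rightarrow> bool" where
  "orthonormal_fam k u \<longleftrightarrow> (\<forall>i<k. \<forall>j<k. hinner (u i) (u j) = (if i = j then 1 else 0))"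

text \<open>The type \<^typ>\<open>complex^'n\<close> carries the Euclidean norm, so its operator norm is the
  spectral norm. (The \<^const>\<open>norm\<close> of a matrix would be the Frobenius norm.)\<close>

definition spec_norm :: "complex^'n^'m \<Rightarrow> real" where
  "spec_norm G = onorm (\<lambda>x. G *v x)"

definition pair_norm :: "complex^'n^'m \<Rightarrow> complex^'m \<Rightarrow> real" where
  "pair_norm G d = sqrt ((spec_norm G)\<^sup>2 + (norm d)\<^sup>2)"

text \<open>The Moore-Penrose inverse, characterized by the four Penrose conditions.\<close>

definition pinv :: "complex^'n^'m \<Rightarrow> complex^'m^'n" where
  "pinv G = (THE X. G ** X ** G = G \<and> X ** G ** X = X \<and>
                    hadjoint (G ** X) = G ** X \<and> hadjoint (X ** G) = X ** G)"

text \<open>Thin singular value decomposition with $\min(m,n)$ terms; the $j$-th largest singular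
  value of $G$ (counted with multiplicity) is \<open>s (j - 1)\<close>.\<close>

definition is_svd ::
  "complex^'n^'m \<Rightarrow> (nat \<Rightarrow> real) \<Rightarrow> (nat \<Rightarrow> complex^'m) \<Rightarrow> (nat \<Rightarrow> complex^'n) \<Rightarrow> bool" where
  "is_svd G s u v \<longleftrightarrow>
     (let r = min CARD('m) CARD('n) in
        (\<forall>j<r. 0 \<le> s j) \<and> (\<forall>i j. i \<le> j \<and> j < r \<longrightarrow> s j \<le> s i) \<and>
        orthonormal_fam r u \<and> orthonormal_fam r v \<and>
        G = (\<Sum>j<r. s j *\<^sub>R outer (u j) (v j)))"

definition singular_values :: "complex^'n^'m \<Rightarrow> real set" where
  "singular_values (G :: complex^'n^'m) =
     {s j | s u v j. is_svd G s u v \<and> j < min CARD('m) CARD('n)}"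

text \<open>The matrix does not depend on the choice of the singular value decomposition.\<close>

definition theta_proj :: "real \<Rightarrow> complex^'n^'m \<Rightarrow> complex^'n^'m" where
  "theta_proj \<theta> (G :: complex^'n^'m) =
     (if \<theta> \<in> singular_values G then undefined
      else THE B. \<exists>s u v. is_svd G s u v \<and>
             B = (\<Sum>j | j < min CARD('m) CARD('n) \<and> s j > \<theta>. s j *\<^sub>R outer (u j) (v j)))"

definition theta_rhs :: "real \<Rightarrow> complex^'n^'m \<Rightarrow> complex^'m \<Rightarrow> complex^'m" where
  "theta_rhs \<theta> G d = (theta_proj \<theta> G ** pinv (theta_proj \<theta> G)) *v d"

definition sol :: "complex^'n^'m \<Rightarrow> complex^'m \<Rightarrow> (complex^'n) set" where
  "sol G d = {u. G *v u = d}"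

definition backward_error :: "real \<Rightarrow> complex^'n^'m \<Rightarrow> complex^'m \<Rightarrow> real" where
  "backward_error \<theta> G d = pair_norm (G - theta_proj \<theta> G) (d - theta_rhs \<theta> G d)"

definition sol_theta_defined :: "real \<Rightarrow> complex^'n^'m \<Rightarrow> complex^'m \<Rightarrow> bool" where
  "sol_theta_defined \<theta> G d \<longleftrightarrow>
     \<theta> > 0 \<and> \<theta> \<notin> singular_values G \<and> backward_error \<theta> G d \<noteq> \<theta>"

definition sol_theta :: "real \<Rightarrow> complex^'n^'m \<Rightarrow> complex^'m \<Rightarrow> (complex^'n) set" where
  "sol_theta \<theta> G d =
     (if \<not> sol_theta_defined \<theta> G d then undefined
      else if backward_error \<theta> G d < \<theta> then sol (theta_proj \<theta> G) (theta_rhs \<theta> G d)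
      else {})"

text \<open>For orthonormal columns $p_0,\dots,p_{k-1}$ of $P$ that span $V$, the matrix
  $P P^H$ is $\sum_j p_j p_j^H$; it depends only on $V$.\<close>

definition orth_proj_mat :: "(complex^'n) set \<Rightarrow> complex^'n^'n" where
  "orth_proj_mat V = (THE M. \<exists>k p. orthonormal_fam k p \<and> vec.span (p ` {..<k}) = V \<and>
                                   M = (\<Sum>j<k. outer (p j) (p j)))"

definition subspace_dist :: "(complex^'n) set \<Rightarrow> (complex^'n) set \<Rightarrow> real" where
  "subspace_dist V W = spec_norm (orth_proj_mat V - orth_proj_mat W)"

text \<open>Complex affine subspaces; the library's \<^const>\<open>affine\<close> is about real scalars.\<close>

definition caffine :: "(complex^'n) set \<Rightarrow> bool" where
  "caffine S \<longleftrightarrow> (\<exists>u V. vec.subspace V \<and> S = (\<lambda>x. u + x) ` V)"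

text \<open>The subspace \<open>V\<close> of an affine subspace \<open>u + V\<close>.\<close>

definition direction :: "(complex^'n) set \<Rightarrow> (complex^'n) set" where
  "direction S = {x - y | x y. x \<in> S \<and> y \<in> S}"

definition min_norm_elt :: "(complex^'n) set \<Rightarrow> complex^'n" where
  "min_norm_elt S = (THE x. x \<in> S \<and> (\<forall>v\<in>direction S. hinner x v = 0))"

definition aff_dist_defined :: "(complex^'n) set \<Rightarrow> (complex^'n) set \<Rightarrow> bool" where
  "aff_dist_defined S T \<longleftrightarrow>
     (S = {} \<and> T = {}) \<or>
     (caffine S \<and> caffine T \<and> vec.dim (direction S) = vec.dim (direction T))"

text \<open>Meaningful only if \<^const>\<open>aff_dist_defined\<close> holds.\<close>

definition aff_dist :: "(complex^'n) set \<Rightarrow> (complex^'n) set \<Rightarrow> real" where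
  "aff_dist S T =
     (if S = {} \<and> T = {} then 0
      else max (norm (min_norm_elt S - min_norm_elt T))
               (subspace_dist (direction S) (direction T)))"

text \<open>An upper bound on the distance, including the assertion that the distance is defined.\<close>

definition aff_dist_le :: "(complex^'n) set \<Rightarrow> (complex^'n) set \<Rightarrow> real \<Rightarrow> bool" where
  "aff_dist_le S T c \<longleftrightarrow> aff_dist_defined S T \<and> aff_dist S T \<le> c"

end

theory Submission
  imports Defs
begin

text \<open>
  Everything rests on one observation: the \<open>\<theta>\<close>-projection of \<open>G\<close>, the right-hand side projected
  onto its range, and the solution set they determine are all functions of a single matrix
  \<open>W\<close>, the Moore--Penrose inverse of the \<open>\<theta>\<close>-projection. Indeed \<open>G\<^sub>\<theta> = G W G\<close>, the projection onto the
  range of \<open>G\<^sub>\<theta>\<close> is \<open>Q = G W\<close>, the projection onto the orthogonal complement of its kernel is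
  \<open>P = W G\<close>, and the solution set is the fibre \<open>P x = W d\<close>, whose point of least norm is \<open>W d\<close>.
  Such a \<open>W\<close> satisfies three of the four Penrose conditions for \<open>G\<close>; what makes it the inverse of
  the part of \<open>G\<close> above \<open>\<theta>\<close> are two norm bounds, \<open>\<parallel>W\<parallel> \<le> 1/c\<close> and \<open>\<parallel>G - G W G\<parallel> \<le> a\<close> with
  \<open>a < \<theta> < c\<close> (\<open>singular_gap\<close>). Working with such \<open>W\<close> replaces all later reasoning about
  singular vectors and multiplicities by algebra of a few matrices.

  Two perturbation results are needed, for matrices \<open>A\<close> and \<open>B\<close> with \<open>\<parallel>A - B\<parallel> = e\<close>. First, a gap
  \<open>(a, c)\<close> in the singular values of \<open>A\<close> leaves the gap \<open>(a + e, c - e)\<close> for \<open>B\<close>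
  (\<open>no_singular_value_in_gap\<close>, \<open>singular_gap_perturbed\<close>), so \<open>B\<close> has its own truncated inverse \<open>W'\<close>.
  Second, a sine-theta theorem of Wedin type bounds both \<open>\<parallel>W A - W' B\<parallel>\<close> and \<open>\<parallel>A W - B W'\<parallel>\<close> by \<open>e\<close>
  divided by the distance between the part of one matrix that is kept and the part of the other that
  is dropped (\<open>sin_theta\<close>). Applied with \<open>A = B\<close> it shows that the
  \<open>\<theta>\<close>-projection does not depend on the chosen singular value decomposition. A bound smaller than 1
  on the difference of the projections forces the kernels to have equal dimension, so that the
  distance between the two solution sets is defined.

  Part (i) is the case where \<open>\<theta>\<close> lies below every positive singular value, so nothing but \<open>0\<close> is
  truncated and \<open>W\<close> is the Moore--Penrose inverse of \<open>A\<close> (\<open>sol_theta_exact\<close>). For part (ii) the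
  identity \<open>W' - W = W' (Q' - Q) + W' (A - B) W + (P' - P) W\<close> turns the sine-theta bounds into a
  Lipschitz bound for \<open>W d\<close> and for the backward error, and the latter keeps the perturbed problem on
  the same side of the threshold (\<open>sol_theta_lipschitz\<close>). Part (iii)(a) needs sharp constants: the
  deviation \<open>W' d' - W d\<close> splits into two orthogonal pieces, one inside and one outside the range of
  \<open>P'\<close>, and the constant arises from adding their squares (\<open>sol_theta_consistent\<close>). Part (iii)(b)
  follows from (i) and (ii), because the distance to the empty set is defined for the empty set only.
\<close>

section \<open>The Hermitian inner product, adjoints and the spectral norm\<close>

lemma hinner_add_left: "hinner (x + y) z = hinner x z + hinner y z"
  by (simp add: hinner_def sum.distrib algebra_simps)

lemma hinner_diff_left: "hinner (x - y) z = hinner x z - hinner y z"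
  by (simp add: hinner_def sum_subtractf algebra_simps)

lemma hinner_scale_left: "hinner (c *s x) y = c * hinner x y"
  by (simp add: hinner_def sum_distrib_left algebra_simps)

lemma hinner_scaleR_left: "hinner (r *\<^sub>R x) y = of_real r * hinner x y"
  by (simp add: hinner_def sum_distrib_left) (simp add: scaleR_conv_of_real mult_ac)

lemma hinner_zero_left [simp]: "hinner 0 y = 0"
  by (simp add: hinner_def)

lemma hinner_sum_left: "hinner (sum f S) y = (\<Sum>i\<in>S. hinner (f i) y)"
  by (induction S rule: infinite_finite_induct) (auto simp: hinner_add_left)

lemma cnj_hinner: "cnj (hinner x y) = hinner y x"
  by (simp add: hinner_def mult_ac)

lemma hinner_eq_zero_commute: "hinner x y = 0 \<longleftrightarrow> hinner y x = 0"
  using cnj_hinner[of x y] by (metis complex_cnj_zero_iff)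

lemma hinner_add_right: "hinner z (x + y) = hinner z x + hinner z y"
  by (metis cnj_hinner complex_cnj_add hinner_add_left)

lemma hinner_diff_right: "hinner z (x - y) = hinner z x - hinner z y"
  by (metis cnj_hinner complex_cnj_diff hinner_diff_left)

lemma hinner_scale_right: "hinner y (c *s x) = cnj c * hinner y x"
  by (metis cnj_hinner complex_cnj_mult hinner_scale_left)

lemma hinner_scaleR_right: "hinner y (r *\<^sub>R x) = of_real r * hinner y x"
  by (metis cnj_hinner complex_cnj_mult complex_cnj_complex_of_real hinner_scaleR_left)

lemma hinner_zero_right [simp]: "hinner y 0 = 0"
  by (simp add: hinner_def)

lemma hinner_sum_right: "hinner y (sum f S) = (\<Sum>i\<in>S. hinner y (f i))"
  by (induction S rule: infinite_finite_induct) (auto simp: hinner_add_right)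

lemma hinner_self: "hinner x x = of_real ((norm x)\<^sup>2)"
proof -
  have "(norm x)\<^sup>2 = (\<Sum>i\<in>UNIV. (norm (x $ i))\<^sup>2)"
    by (simp add: norm_vec_def L2_set_def sum_nonneg)
  then show ?thesis
    by (simp only: hinner_def complex_norm_square[symmetric] of_real_sum)
qed

lemma hinner_self_eq_zero [simp]: "hinner x x = 0 \<longleftrightarrow> x = 0"
  by (simp add: hinner_self)

lemma norm_hinner_le: "norm (hinner x y) \<le> norm x * norm y"
proof -
  have "norm (hinner x y) \<le> (\<Sum>i\<in>UNIV. norm (x $ i) * norm (y $ i))"
    unfolding hinner_def by (rule order_trans[OF norm_sum]) (simp add: norm_mult)
  also have "\<dots> \<le> norm x * norm y"
    using L2_set_mult_ineq[of "\<lambda>i. norm (x $ i)" "\<lambda>i. norm (y $ i)" UNIV]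
    by (simp add: norm_vec_def)
  finally show ?thesis .
qed

lemma norm_scale [simp]: "norm (c *s (x :: complex^'n)) = norm c * norm x"
  by (simp add: norm_vec_def norm_mult L2_set_right_distrib)

lemma Re_hinner_self [simp]: "Re (hinner x x) = (norm x)\<^sup>2"
  by (simp only: hinner_self Re_complex_of_real)

lemma norm_hinner_self [simp]: "norm (hinner x x) = (norm x)\<^sup>2"
  by (simp only: hinner_self norm_of_real abs_power2)

lemma norm_add_power2:
  "(norm (x + y))\<^sup>2 = (norm x)\<^sup>2 + (norm y)\<^sup>2 + 2 * Re (hinner x y)" for x y :: "complex^'n"
proof -
  have "hinner (x + y) (x + y) = hinner x x + hinner y y + (hinner x y + cnj (hinner x y))"
    by (simp add: hinner_add_left hinner_add_right cnj_hinner)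
  from arg_cong[OF this, of Re] show ?thesis by simp
qed

lemma pythagoras:
  fixes x y :: "complex^'n"
  assumes "hinner x y = 0"
  shows "(norm (x + y))\<^sup>2 = (norm x)\<^sup>2 + (norm y)\<^sup>2"
  using assms by (simp add: norm_add_power2)

lemma matrix_add_rdistrib: "(A + B) ** C = A ** C + B ** (C :: 'a::semiring_1^_^_)"
  by (vector matrix_matrix_mult_def sum.distrib[symmetric] distrib_right)

lemma matrix_diff_ldistrib: "A ** (B - C) = A ** B - A ** (C :: 'a::ring_1^_^_)"
  by (vector matrix_matrix_mult_def sum_subtractf[symmetric] right_diff_distrib)

lemma matrix_diff_rdistrib: "(A - B) ** C = A ** C - B ** (C :: 'a::ring_1^_^_)"
  by (vector matrix_matrix_mult_def sum_subtractf[symmetric] left_diff_distrib)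

lemma matrix_mult_zero_left [simp]: "0 ** (A :: 'a::semiring_1^_^_) = 0"
  by (vector matrix_matrix_mult_def)

lemma matrix_mult_zero_right [simp]: "(A :: 'a::semiring_1^_^_) ** 0 = 0"
  by (vector matrix_matrix_mult_def)

lemma matrix_vector_mult_sum_left: "(\<Sum>i\<in>S. F i) *v x = (\<Sum>i\<in>S. F i *v x)" for x :: "complex^'n"
  by (induction S rule: infinite_finite_induct) (auto simp: matrix_vector_mult_add_rdistrib)

lemma matrix_vector_mult_sum_right: "A *v (\<Sum>i\<in>S. f i) = (\<Sum>i\<in>S. A *v f i)" for A :: "complex^'n^'m"
  by (induction S rule: infinite_finite_induct) (auto simp: matrix_vector_right_distrib)

lemma matrix_vector_mult_scaleR_left: "(r *\<^sub>R A) *v x = r *\<^sub>R (A *v x)" for A :: "complex^'n^'m"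
  by (simp add: vec_eq_iff matrix_vector_mult_def scaleR_sum_right)

lemma matrix_vector_mult_scale: "A *v (c *s x) = c *s (A *v x)" for A :: "complex^'n^'m"
  by (simp add: vec_eq_iff matrix_vector_mult_def sum_distrib_left mult_ac)

lemma hadjoint_hadjoint [simp]: "hadjoint (hadjoint G) = G"
  by (simp add: hadjoint_def vec_eq_iff)

lemma hadjoint_add: "hadjoint (A + B) = hadjoint A + hadjoint B"
  by (simp add: hadjoint_def vec_eq_iff)

lemma hadjoint_diff: "hadjoint (A - B) = hadjoint A - hadjoint B"
  by (simp add: hadjoint_def vec_eq_iff)

lemma hadjoint_mult: "hadjoint (A ** B) = hadjoint B ** hadjoint A"
  by (simp add: hadjoint_def vec_eq_iff matrix_matrix_mult_def mult_ac)

lemma hadjoint_scaleR: "hadjoint (r *\<^sub>R A) = r *\<^sub>R hadjoint A"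
  by (simp add: hadjoint_def vec_eq_iff)

lemma hadjoint_zero [simp]: "hadjoint 0 = 0"
  by (simp add: hadjoint_def vec_eq_iff)

lemma hadjoint_sum: "hadjoint (\<Sum>i\<in>S. F i) = (\<Sum>i\<in>S. hadjoint (F i))"
  by (induction S rule: infinite_finite_induct) (auto simp: hadjoint_add)

lemma hadjoint_mat_1 [simp]: "hadjoint (mat 1) = mat 1"
  by (auto simp: hadjoint_def vec_eq_iff mat_def)

lemma hadjoint_outer: "hadjoint (outer x y) = outer y x"
  by (simp add: hadjoint_def outer_def vec_eq_iff mult_ac)

lemma hinner_hadjoint_right: "hinner (G *v x) y = hinner x (hadjoint G *v y)"
proof -
  have "hinner (G *v x) y = (\<Sum>i\<in>UNIV. \<Sum>j\<in>UNIV. G $ i $ j * x $ j * cnj (y $ i))"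
    by (simp add: hinner_def matrix_vector_mult_def sum_distrib_right)
  also have "\<dots> = (\<Sum>j\<in>UNIV. \<Sum>i\<in>UNIV. G $ i $ j * x $ j * cnj (y $ i))"
    by (rule sum.swap)
  also have "\<dots> = hinner x (hadjoint G *v y)"
    by (simp add: hinner_def matrix_vector_mult_def hadjoint_def sum_distrib_left mult_ac)
  finally show ?thesis .
qed

lemma hinner_hadjoint_left: "hinner (hadjoint G *v x) y = hinner x (G *v y)"
  using hinner_hadjoint_right[of "hadjoint G" x y] by simp

lemma outer_mult_vector: "outer u v *v x = hinner x v *s u"
  by (simp add: vec_eq_iff outer_def matrix_vector_mult_def hinner_def sum_distrib_left mult_ac)

lemma matrix_eqI: "(\<And>x. A *v x = B *v x) \<Longrightarrow> A = B" for A :: "complex^'n^'m"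
  by (simp add: matrix_eq)

lemma norm_mult_le_spec_norm: "norm (G *v x) \<le> spec_norm G * norm x"
  unfolding spec_norm_def by (rule onorm[OF matrix_vector_mul_bounded_linear])

lemma spec_norm_le: "(\<And>x. norm (G *v x) \<le> C * norm x) \<Longrightarrow> spec_norm G \<le> C"
  unfolding spec_norm_def by (rule onorm_le)

lemma spec_norm_nonneg [simp]: "0 \<le> spec_norm G"
  unfolding spec_norm_def by (rule onorm_pos_le[OF matrix_vector_mul_bounded_linear])

lemma spec_norm_eq_zero [simp]: "spec_norm G = 0 \<longleftrightarrow> G = 0"
proof -
  have "spec_norm G = 0 \<longleftrightarrow> (\<forall>x. G *v x = 0)"
    unfolding spec_norm_def by (rule onorm_eq_0[OF matrix_vector_mul_bounded_linear])
  also have "\<dots> \<longleftrightarrow> G = 0"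
    by (auto simp: matrix_eq)
  finally show ?thesis .
qed

lemma spec_norm_zero [simp]: "spec_norm 0 = 0"
  by simp

lemma spec_norm_mult: "spec_norm (A ** B) \<le> spec_norm A * spec_norm B"
proof (rule spec_norm_le)
  fix x
  have "norm (A *v (B *v x)) \<le> spec_norm A * norm (B *v x)"
    by (rule norm_mult_le_spec_norm)
  also have "\<dots> \<le> spec_norm A * (spec_norm B * norm x)"
    by (intro mult_left_mono norm_mult_le_spec_norm) simp
  finally show "norm ((A ** B) *v x) \<le> spec_norm A * spec_norm B * norm x"
    by (simp add: matrix_vector_mul_assoc mult.assoc)
qed

lemma spec_norm_triangle: "spec_norm (A + B) \<le> spec_norm A + spec_norm B"
proof (rule spec_norm_le)
  fix x
  show "norm ((A + B) *v x) \<le> (spec_norm A + spec_norm B) * norm x"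
    using norm_triangle_ineq[of "A *v x" "B *v x"] norm_mult_le_spec_norm[of A x]
      norm_mult_le_spec_norm[of B x]
    by (simp add: matrix_vector_mult_add_rdistrib distrib_right)
qed

lemma spec_norm_minus [simp]: "spec_norm (- A) = spec_norm A"
proof -
  have "(- A) *v x = - (A *v x)" for x
    by (metis add.right_inverse add_eq_0_iff matrix_vector_mult_0 matrix_vector_mult_add_rdistrib)
  then show ?thesis
    by (simp add: spec_norm_def onorm_neg)
qed

lemma spec_norm_minus_commute: "spec_norm (A - B) = spec_norm (B - A)"
  using spec_norm_minus[of "A - B"] by simp

lemma spec_norm_hadjoint_le: "spec_norm (hadjoint H) \<le> spec_norm H"
proof (rule spec_norm_le)
  fix y
  let ?z = "hadjoint H *v y"
  have "(norm ?z)\<^sup>2 = norm (hinner ?z ?z)"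
    by simp
  also have "\<dots> = norm (hinner y (H *v ?z))"
    by (simp add: hinner_hadjoint_left)
  also have "\<dots> \<le> norm y * (spec_norm H * norm ?z)"
    using norm_hinner_le[of y "H *v ?z"] norm_mult_le_spec_norm[of H ?z]
    by (meson mult_left_mono norm_ge_zero order_trans)
  finally have "norm ?z * norm ?z \<le> (spec_norm H * norm y) * norm ?z"
    by (simp add: power2_eq_square mult_ac)
  then show "norm ?z \<le> spec_norm H * norm y"
    by (cases "norm ?z = 0") (auto dest: mult_right_le_imp_le)
qed

lemma spec_norm_hadjoint [simp]: "spec_norm (hadjoint G) = spec_norm G"
  using spec_norm_hadjoint_le[of G] spec_norm_hadjoint_le[of "hadjoint G"] by simp

lemma pair_norm_nonneg [simp]: "0 \<le> pair_norm G d"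
  by (simp add: pair_norm_def)

lemma spec_norm_le_pair_norm: "spec_norm G \<le> pair_norm G d"
  by (simp add: pair_norm_def real_le_rsqrt)

lemma norm_le_pair_norm: "norm d \<le> pair_norm G d"
  by (simp add: pair_norm_def real_le_rsqrt)

lemma pair_norm_le_add: "pair_norm G d \<le> spec_norm G + norm d"
  unfolding pair_norm_def by (rule sqrt_sum_squares_le_sum) auto

lemma pair_norm_triangle: "pair_norm (G + G') (d + d') \<le> pair_norm G d + pair_norm G' d'"
proof -
  have "pair_norm (G + G') (d + d') \<le>
      sqrt ((spec_norm G + spec_norm G')\<^sup>2 + (norm d + norm d')\<^sup>2)"
    unfolding pair_norm_def
    by (intro real_sqrt_le_mono add_mono power_mono spec_norm_triangle norm_triangle_ineq) auto
  also have "\<dots> \<le> pair_norm G d + pair_norm G' d'"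
    unfolding pair_norm_def by (rule real_sqrt_sum_squares_triangle_ineq)
  finally show ?thesis .
qed

lemma pair_norm_minus_commute: "pair_norm (A - B) (a - b) = pair_norm (B - A) (b - a)"
  by (simp add: pair_norm_def spec_norm_minus_commute norm_minus_commute)

section \<open>Orthonormal families\<close>

lemma orthonormal_famD:
  "orthonormal_fam k u \<Longrightarrow> i < k \<Longrightarrow> j < k \<Longrightarrow> hinner (u i) (u j) = (if i = j then 1 else 0)"
  by (simp add: orthonormal_fam_def)

lemma orthonormal_fam_norm: "orthonormal_fam k u \<Longrightarrow> i < k \<Longrightarrow> norm (u i) = 1"
  using norm_hinner_self[of "u i"]
  by (simp add: orthonormal_famD)
    (metis norm_ge_zero one_power2 power2_eq_iff_nonneg zero_le_one)

lemma orthonormal_fam_mono: "orthonormal_fam k u \<Longrightarrow> l \<le> k \<Longrightarrow> orthonormal_fam l u"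
  by (auto simp: orthonormal_fam_def)

lemma orthonormal_fam_Suc:
  assumes "orthonormal_fam k u" "norm y = 1" "\<forall>i<k. hinner y (u i) = 0"
  shows "orthonormal_fam (Suc k) (u(k := y))"
  using assms hinner_self[of y] by (auto simp: orthonormal_fam_def less_Suc_eq hinner_eq_zero_commute[of _ y])

lemma hinner_sum_orthonormal:
  assumes "orthonormal_fam k u" "i < k"
  shows "hinner (\<Sum>j<k. c j *s u j) (u i) = c i"
proof -
  have "hinner (\<Sum>j<k. c j *s u j) (u i) = (\<Sum>j<k. if j = i then c j else 0)"
    unfolding hinner_sum_left using assms
    by (intro sum.cong) (auto simp: hinner_scale_left orthonormal_famD)
  then show ?thesis using assms by simp
qed

lemma norm_sum_orthonormal:
  assumes "orthonormal_fam k u"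
  shows "(norm (\<Sum>j<k. c j *s u j))\<^sup>2 = (\<Sum>j<k. (norm (c j))\<^sup>2)"
proof -
  have "hinner (\<Sum>j<k. c j *s u j) (\<Sum>j<k. c j *s u j) = (\<Sum>i<k. of_real ((norm (c i))\<^sup>2))"
    unfolding hinner_sum_right[of "\<Sum>j<k. c j *s u j"]
    by (intro sum.cong)
      (auto simp only: hinner_scale_right hinner_sum_orthonormal[OF assms] complex_norm_square
        mult.commute lessThan_iff)
  from arg_cong[OF this, of Re] show ?thesis by simp
qed

lemma hinner_residual_orthonormal:
  assumes "orthonormal_fam k u" "i < k"
  shows "hinner (x - (\<Sum>j<k. hinner x (u j) *s u j)) (u i) = 0"
  using hinner_sum_orthonormal[OF assms, of "\<lambda>j. hinner x (u j)"] by (simp add: hinner_diff_left)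

lemma bessel:
  assumes "orthonormal_fam k u"
  shows "(\<Sum>j<k. (norm (hinner x (u j)))\<^sup>2) \<le> (norm x)\<^sup>2"
proof -
  let ?T = "\<Sum>j<k. hinner x (u j) *s u j"
  have "hinner (x - ?T) ?T = 0"
    by (subst hinner_sum_right)
      (simp add: hinner_scale_right hinner_residual_orthonormal[OF assms])
  from pythagoras[OF this] show ?thesis
    by (simp add: norm_sum_orthonormal[OF assms])
qed

lemma orthonormal_fam_inj: "orthonormal_fam k u \<Longrightarrow> inj_on u {..<k}"
  by (rule inj_onI) (metis lessThan_iff orthonormal_famD zero_neq_one)

lemma orthonormal_fam_card_le:
  fixes u :: "nat \<Rightarrow> complex^'n"
  assumes "orthonormal_fam k u"
  shows "k \<le> CARD('n)"
proof -
  have inj: "inj_on u {..<k}"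
    by (rule orthonormal_fam_inj[OF assms])
  have "vec.independent (u ` {..<k})"
  proof (rule vec.independent_if_scalars_zero)
    fix f x
    assume 0: "(\<Sum>x\<in>u ` {..<k}. f x *s x) = 0" and "x \<in> u ` {..<k}"
    then obtain i where i: "i < k" "x = u i" by auto
    have "(\<Sum>j<k. f (u j) *s u j) = 0"
      using 0 by (simp add: sum.reindex[OF inj])
    then show "f x = 0"
      using hinner_sum_orthonormal[OF assms \<open>i < k\<close>, of "\<lambda>j. f (u j)"] i by simp
  qed simp
  then have "card (u ` {..<k}) \<le> vec.dim (UNIV :: (complex^'n) set)"
    by (intro vec.independent_card_le_dim) auto
  then show ?thesis
    by (simp add: card_image[OF inj] card_cart_basis)
qed

text \<open>One Gram--Schmidt step.\<close>

lemma orthonormal_fam_extend: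
  assumes u: "orthonormal_fam k u" and V: "vec.subspace V" "u ` {..<k} \<subseteq> V"
    and x: "x \<in> V" "x \<notin> vec.span (u ` {..<k})"
  obtains y where "y \<in> V" "norm y = 1" "\<forall>i<k. hinner y (u i) = 0"
proof -
  define T where "T = (\<Sum>j<k. hinner x (u j) *s u j)"
  have T: "T \<in> vec.span (u ` {..<k})"
    unfolding T_def by (intro vec.span_sum vec.span_scale vec.span_base) auto
  have "x - T \<noteq> 0" using x T by auto
  define y where "y = of_real (1 / norm (x - T)) *s (x - T)"
  have "T \<in> V" using T vec.span_minimal[OF V(2,1)] by auto
  then have "y \<in> V"
    unfolding y_def using V x by (intro vec.subspace_scale vec.subspace_diff)
  moreover have "norm y = 1"
    using \<open>x - T \<noteq> 0\<close> unfolding y_def norm_scale by (simp add: norm_divide)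
  moreover have "\<forall>i<k. hinner y (u i) = 0"
    using hinner_residual_orthonormal[OF u]
    unfolding y_def hinner_scale_left T_def by simp
  ultimately show ?thesis by (rule that)
qed

lemma exists_unit_orthogonal:
  fixes u :: "nat \<Rightarrow> complex^'n"
  assumes u: "orthonormal_fam k u" and k: "k < CARD('n)"
  obtains y where "norm y = 1" "\<forall>i<k. hinner y (u i) = 0"
proof -
  have "vec.span (u ` {..<k}) \<noteq> UNIV"
  proof
    assume "vec.span (u ` {..<k}) = UNIV"
    then have "vec.dim (UNIV :: (complex^'n) set) \<le> card (u ` {..<k})"
      by (intro vec.dim_le_card) auto
    also have "\<dots> \<le> k" using card_image_le[of "{..<k}" u] by simp
    finally show False using k by (simp add: card_cart_basis)
  qed
  then obtain x where "x \<notin> vec.span (u ` {..<k})" by auto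
  from orthonormal_fam_extend[OF u vec.subspace_UNIV _ _ this] that show ?thesis by auto
qed

lemma orthonormal_fam_completion:
  fixes u :: "nat \<Rightarrow> complex^'n"
  assumes "orthonormal_fam k u" "k \<le> r" "r \<le> CARD('n)"
  shows "\<exists>u'. orthonormal_fam r u' \<and> (\<forall>j<k. u' j = u j)"
  using assms(2,3)
proof (induction r rule: dec_induct)
  case base
  then show ?case using assms by blast
next
  case (step r)
  then obtain u' where u': "orthonormal_fam r u'" "\<forall>j<k. u' j = u j" by auto
  obtain y where "norm y = 1" "\<forall>i<r. hinner y (u' i) = 0"
    using exists_unit_orthogonal[OF u'(1)] step by auto
  then have "orthonormal_fam (Suc r) (u'(r := y))"
    by (rule orthonormal_fam_Suc[OF u'(1)])
  then show ?case
    using u'(2) step.hyps by (intro exI[of _ "u'(r := y)"]) (simp del: fun_upd_apply, simp)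
qed

lemma orthonormal_basis_expansion:
  fixes u :: "nat \<Rightarrow> complex^'n"
  assumes u: "orthonormal_fam CARD('n) u"
  shows "x = (\<Sum>j<CARD('n). hinner x (u j) *s u j)"
proof -
  have "vec.span (u ` {..<CARD('n)}) = UNIV"
  proof (rule ccontr)
    assume "\<not> ?thesis"
    then obtain x where "x \<notin> vec.span (u ` {..<CARD('n)})" by auto
    from orthonormal_fam_extend[OF u vec.subspace_UNIV _ _ this]
    obtain y where "norm y = 1" "\<forall>i<CARD('n). hinner y (u i) = 0" by auto
    from orthonormal_fam_card_le[OF orthonormal_fam_Suc[OF u this]] show False by simp
  qed
  define T where "T = (\<Sum>j<CARD('n). hinner x (u j) *s u j)"
  have "vec.span (u ` {..<CARD('n)}) \<subseteq> {y. hinner (x - T) y = 0}"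
    using hinner_residual_orthonormal[OF u, of _ x]
    by (intro vec.span_minimal)
      (auto simp: T_def vec.subspace_def hinner_add_right hinner_scale_right)
  with \<open>vec.span (u ` {..<CARD('n)}) = UNIV\<close> have "hinner (x - T) (x - T) = 0" by blast
  then show ?thesis by (simp add: T_def)
qed

section \<open>Existence of the singular value decomposition\<close>

lemma exists_maximal_unit_vector:
  fixes G :: "complex^'n^'m" and v :: "nat \<Rightarrow> complex^'n"
  assumes "orthonormal_fam k v" "k < CARD('n)"
  obtains x where "norm x = 1" "\<forall>i<k. hinner x (v i) = 0"
    "\<And>y. norm y = 1 \<Longrightarrow> \<forall>i<k. hinner y (v i) = 0 \<Longrightarrow> norm (G *v y) \<le> norm (G *v x)"
proof -
  let ?S = "{x. norm x = 1 \<and> (\<forall>i<k. hinner x (v i) = 0)}"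
  have cont: "continuous_on UNIV (\<lambda>x :: complex^'n. hinner x w)" for w
    unfolding hinner_def by (intro continuous_intros)
  have "?S = sphere 0 1 \<inter> (\<Inter>i\<in>{..<k}. {x. hinner x (v i) = 0})" by auto
  moreover have "closed (\<Inter>i\<in>{..<k}. {x. hinner x (v i) = 0})"
    by (intro closed_INT ballI closed_Collect_eq cont continuous_intros)
  ultimately have "compact ?S" by (simp add: compact_Int_closed)
  moreover obtain y where "norm y = 1" "\<forall>i<k. hinner y (v i) = 0"
    using exists_unit_orthogonal[OF assms] .
  then have "?S \<noteq> {}" by blast
  moreover have "continuous_on ?S (\<lambda>x. norm (G *v x))"
    by (intro continuous_on_norm linear_continuous_on matrix_vector_mul_bounded_linear)
  ultimately have "\<exists>x\<in>?S. \<forall>y\<in>?S. norm (G *v y) \<le> norm (G *v x)"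
    by (intro continuous_attains_sup)
  then obtain x where "x \<in> ?S" "\<forall>y\<in>?S. norm (G *v y) \<le> norm (G *v x)" by blast
  then show ?thesis by (intro that) auto
qed

text \<open>First-order optimality: if \<open>v\<close> maximises the norm of the image among the unit vectors in a
  subspace, then moving towards an orthogonal \<open>w\<close> cannot increase it to first order in the step
  size, which forces the images of \<open>v\<close> and \<open>w\<close> to be orthogonal.\<close>

lemma maximal_vector_image_orthogonal:
  fixes G :: "complex^'n^'m"
  assumes v: "norm v = 1" and w: "norm w = 1" and vw: "hinner v w = 0"
    and max: "\<And>t. norm (G *v (v + t *s w)) \<le> norm (G *v v) * norm (v + t *s w)"
  shows "hinner (G *v v) (G *v w) = 0"
proof (rule ccontr)
  define g where "g = hinner (G *v v) (G *v w)"
  define M where "M = (norm (G *v v))\<^sup>2"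
  assume "hinner (G *v v) (G *v w) \<noteq> 0"
  then have g: "0 < (norm g)\<^sup>2" by (simp add: g_def)
  have M: "0 \<le> M" by (simp add: M_def)
  have *: "2 * Re (cnj t * g) \<le> (norm t)\<^sup>2 * M" for t
  proof -
    have "(norm (G *v (v + t *s w)))\<^sup>2 \<le> (norm (G *v v) * norm (v + t *s w))\<^sup>2"
      by (intro power_mono max) simp
    also have "\<dots> = M * (1 + (norm t)\<^sup>2)"
      using pythagoras[of v "t *s w"] v w vw
      by (simp add: hinner_scale_right power_mult_distrib M_def)
    finally have "(norm (G *v v + t *s (G *v w)))\<^sup>2 \<le> M * (1 + (norm t)\<^sup>2)"
      by (simp add: matrix_vector_right_distrib matrix_vector_mult_scale)
    moreover have "(norm (G *v v + t *s (G *v w)))\<^sup>2 =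
        M + (norm (t *s (G *v w)))\<^sup>2 + 2 * Re (cnj t * g)"
      unfolding norm_add_power2 by (simp only: M_def g_def hinner_scale_right)
    moreover have "M * (1 + (norm t)\<^sup>2) = M + (norm t)\<^sup>2 * M"
      by (simp add: algebra_simps)
    ultimately show ?thesis
      using zero_le_power2[of "norm (t *s (G *v w))"] by linarith
  qed
  \<comment> \<open>Along \<open>t = \<tau> g\<close> the left-hand side is linear and the right-hand side quadratic in \<open>\<tau>\<close>, so a
    small \<open>\<tau>\<close> gives the contradiction.\<close>
  define \<tau> where "\<tau> = 1 / (M + 1)"
  have \<tau>: "0 < \<tau>" "\<tau> * M < 2" using M by (auto simp: \<tau>_def field_simps)
  have "2 * (\<tau> * (norm g)\<^sup>2) \<le> \<tau>\<^sup>2 * (norm g)\<^sup>2 * M"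
  proof -
    have "cnj (of_real \<tau> * g) * g = of_real (\<tau> * (norm g)\<^sup>2)"
      by (simp only: complex_cnj_mult complex_cnj_complex_of_real of_real_mult complex_norm_square
          mult.commute mult.left_commute)
    moreover have "(norm (of_real \<tau> * g))\<^sup>2 = \<tau>\<^sup>2 * (norm g)\<^sup>2"
      by (simp add: norm_mult power_mult_distrib)
    ultimately show ?thesis
      using *[of "of_real \<tau> * g"] by (simp only: Re_complex_of_real)
  qed
  then have "2 * (\<tau> * (norm g)\<^sup>2) \<le> (\<tau> * M) * (\<tau> * (norm g)\<^sup>2)"
    by (simp add: power2_eq_square mult_ac)
  then have "2 \<le> \<tau> * M"
    by (rule mult_right_le_imp_le) (use g \<tau>(1) in simp)
  with \<tau> show False by simp
qed

text \<open>These are the right singular vectors: the greedy choice makes the norms of their images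
  decrease and, by first-order optimality, the images orthogonal.\<close>

lemma exists_greedy_basis:
  fixes G :: "complex^'n^'m"
  assumes "k \<le> CARD('n)"
  shows "\<exists>v :: nat \<Rightarrow> complex^'n. orthonormal_fam k v \<and>
    (\<forall>j<k. \<forall>y. norm y = 1 \<and> (\<forall>i<j. hinner y (v i) = 0) \<longrightarrow> norm (G *v y) \<le> norm (G *v v j))"
  using assms
proof (induction k)
  case 0
  then show ?case by (auto simp: orthonormal_fam_def)
next
  case (Suc k)
  then obtain v :: "nat \<Rightarrow> complex^'n" where v: "orthonormal_fam k v"
    "\<forall>j<k. \<forall>y. norm y = 1 \<and> (\<forall>i<j. hinner y (v i) = 0) \<longrightarrow> norm (G *v y) \<le> norm (G *v v j)"
    by auto
  obtain x where x: "norm x = 1" "\<forall>i<k. hinner x (v i) = 0"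
    "\<And>y. norm y = 1 \<Longrightarrow> \<forall>i<k. hinner y (v i) = 0 \<Longrightarrow> norm (G *v y) \<le> norm (G *v x)"
    using exists_maximal_unit_vector[OF v(1), of G] Suc.prems by auto
  have "\<forall>j<Suc k. \<forall>y. norm y = 1 \<and> (\<forall>i<j. hinner y ((v(k := x)) i) = 0) \<longrightarrow>
      norm (G *v y) \<le> norm (G *v (v(k := x)) j)"
    using v(2) x(3) by (auto simp: less_Suc_eq)
  with orthonormal_fam_Suc[OF v(1) x(1,2)] show ?case by blast
qed

text \<open>For the greedy basis \<open>v\<close> the images \<open>G v\<^sub>j\<close> are pairwise orthogonal by first-order optimality and
  their norms decrease by construction. The nonzero ones, normalised, are the left singular vectors;
  being orthonormal in both spaces, there are at most \<open>min m n\<close> of them, and the family is filled up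
  to that length arbitrarily, since the added vectors get the coefficient \<open>0\<close>.\<close>

theorem svd_exists:
  fixes G :: "complex^'n^'m"
  shows "\<exists>s u v. is_svd G s u v"
proof -
  let ?n = "CARD('n)" and ?r = "min CARD('m) CARD('n)"
  obtain v :: "nat \<Rightarrow> complex^'n" where v: "orthonormal_fam ?n v"
    and max: "\<And>j y. j < ?n \<Longrightarrow> norm y = 1 \<Longrightarrow> \<forall>i<j. hinner y (v i) = 0 \<Longrightarrow>
      norm (G *v y) \<le> norm (G *v v j)"
    using exists_greedy_basis[of ?n G] by auto
  define s where "s j = norm (G *v v j)" for j
  have s_nonneg: "0 \<le> s j" for j by (simp add: s_def)
  have s_antimono: "s j \<le> s i" if "i \<le> j" "j < ?n" for i j
    unfolding s_def using that
    by (intro max) (auto simp: orthonormal_fam_norm[OF v] orthonormal_famD[OF v])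
  have images: "hinner (G *v v i) (G *v v j) = 0" if "i < j" "j < ?n" for i j
  proof (rule maximal_vector_image_orthogonal)
    fix t
    let ?y = "v i + t *s v j"
    have "norm ?y \<noteq> 0"
      using pythagoras[of "v i" "t *s v j"] that
      by (auto simp: hinner_scale_right orthonormal_famD[OF v] orthonormal_fam_norm[OF v]
          simp del: norm_eq_zero)
        (metis add_nonneg_eq_0_iff one_neq_zero zero_le_one zero_le_power2)
    then have pos: "norm ?y > 0" by simp
    let ?z = "of_real (1 / norm ?y) *s ?y"
    have "norm (G *v ?z) \<le> norm (G *v v i)"
    proof (rule max)
      show "norm ?z = 1" unfolding norm_scale using pos by (simp add: norm_divide)
      show "\<forall>l<i. hinner ?z (v l) = 0"
        unfolding hinner_scale_left hinner_add_left using that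
        by (simp add: orthonormal_famD[OF v])
    qed (use that in auto)
    then have "norm (1 / norm ?y) * norm (G *v ?y) \<le> norm (G *v v i)"
      unfolding matrix_vector_mult_scale norm_scale norm_of_real by simp
    then show "norm (G *v ?y) \<le> norm (G *v v i) * norm ?y"
      using pos by (simp add: field_simps)
  qed (use that in \<open>auto simp: orthonormal_fam_norm[OF v] orthonormal_famD[OF v]\<close>)
  \<comment> \<open>The rank of \<open>G\<close>.\<close>
  define k where "k = (LEAST k. k = ?n \<or> s k = 0)"
  have k: "k = ?n \<or> s k = 0" unfolding k_def by (rule LeastI[of _ ?n]) simp
  have "k \<le> ?n" unfolding k_def by (rule Least_le) simp
  have pos: "0 < s j" if "j < k" for j
    using not_less_Least[of j "\<lambda>k. k = ?n \<or> s k = 0"] that s_nonneg[of j] by (auto simp: k_def)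
  have zero: "s j = 0" if "k \<le> j" "j < ?n" for j
    using k s_antimono[OF that] s_nonneg[of j] that by auto
  define u0 where "u0 j = (1 / s j) *\<^sub>R (G *v v j)" for j
  have "orthonormal_fam k u0"
    unfolding orthonormal_fam_def
  proof (intro allI impI)
    fix i j assume ij: "i < k" "j < k"
    show "hinner (u0 i) (u0 j) = (if i = j then 1 else 0)"
    proof (cases "i = j")
      case True
      then show ?thesis
        using pos[OF ij(2)]
        by (simp add: u0_def hinner_scaleR_left hinner_scaleR_right hinner_self s_def
            power2_eq_square)
    next
      case False
      then have "hinner (G *v v i) (G *v v j) = 0"
        using images[of i j] images[of j i] ij \<open>k \<le> ?n\<close>
        by (cases "i < j") (auto simp: hinner_eq_zero_commute)
      with False show ?thesis
        by (simp add: u0_def hinner_scaleR_left hinner_scaleR_right)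
    qed
  qed
  moreover from this have "k \<le> ?r"
    using \<open>k \<le> ?n\<close> orthonormal_fam_card_le by auto
  ultimately obtain u where u: "orthonormal_fam ?r u" "\<forall>j<k. u j = u0 j"
    using orthonormal_fam_completion[of k u0 ?r] by auto
  have Gv: "G *v v j = s j *\<^sub>R u j" if "j < ?n" for j
    using u(2) pos[of j] zero[of j] that by (cases "j < k") (auto simp: u0_def s_def)
  have "G = (\<Sum>j<?r. s j *\<^sub>R outer (u j) (v j))"
  proof (rule matrix_eqI)
    fix x
    have "G *v x = G *v (\<Sum>j<?n. hinner x (v j) *s v j)"
      by (simp only: orthonormal_basis_expansion[OF v, symmetric])
    also have "\<dots> = (\<Sum>j<?n. hinner x (v j) *s (s j *\<^sub>R u j))"
      unfolding matrix_vector_mult_sum_right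
      by (intro sum.cong) (auto simp: matrix_vector_mult_scale Gv)
    also have "\<dots> = (\<Sum>j<?r. hinner x (v j) *s (s j *\<^sub>R u j))"
      using \<open>k \<le> ?r\<close> zero by (intro sum.mono_neutral_right) auto
    also have "\<dots> = (\<Sum>j<?r. s j *\<^sub>R outer (u j) (v j)) *v x"
      unfolding matrix_vector_mult_sum_left matrix_vector_mult_scaleR_left outer_mult_vector
      by (intro sum.cong) (auto simp: vec_eq_iff)
    finally show "G *v x = (\<Sum>j<?r. s j *\<^sub>R outer (u j) (v j)) *v x" .
  qed
  then have "is_svd G s u v"
    unfolding is_svd_def Let_def
    using s_nonneg s_antimono u(1) orthonormal_fam_mono[OF v, of ?r] by auto
  then show ?thesis by blast
qed

section \<open>Matrices in singular value form\<close>

text \<open>Singular value form with arbitrary real coefficients. For fixed orthonormal families such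
  matrices multiply, subtract and transpose coefficientwise, so identities between a matrix, its
  truncations and their inverses reduce to identities between real numbers.\<close>

definition dyad_sum ::
  "nat \<Rightarrow> (nat \<Rightarrow> real) \<Rightarrow> (nat \<Rightarrow> complex^'m) \<Rightarrow> (nat \<Rightarrow> complex^'n) \<Rightarrow> complex^'n^'m" where
  "dyad_sum k f u v = (\<Sum>j<k. f j *\<^sub>R outer (u j) (v j))"

lemma hadjoint_dyad_sum: "hadjoint (dyad_sum k f u v) = dyad_sum k f v u"
  by (simp add: dyad_sum_def hadjoint_sum hadjoint_scaleR hadjoint_outer)

lemma of_real_scale: "of_real r *s x = r *\<^sub>R x" for x :: "complex^'n"
  by (simp add: vec_eq_iff complex_eq_iff)

lemma matrix_vector_mult_scaleR_right: "A *v (r *\<^sub>R x) = r *\<^sub>R (A *v x)" for A :: "complex^'n^'m"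
  by (simp only: of_real_scale[symmetric] matrix_vector_mult_scale)

lemma dyad_sum_mult_vector: "dyad_sum k f u v *v x = (\<Sum>j<k. (of_real (f j) * hinner x (v j)) *s u j)"
  unfolding dyad_sum_def matrix_vector_mult_sum_left matrix_vector_mult_scaleR_left outer_mult_vector
  by (intro sum.cong) (auto simp: vec_eq_iff complex_eq_iff algebra_simps)

lemma dyad_sum_mult:
  assumes "orthonormal_fam k v"
  shows "dyad_sum k f u v ** dyad_sum k g v w = dyad_sum k (\<lambda>j. f j * g j) u w"
proof (rule matrix_eqI)
  fix x
  show "(dyad_sum k f u v ** dyad_sum k g v w) *v x = dyad_sum k (\<lambda>j. f j * g j) u w *v x"
    unfolding matrix_vector_mul_assoc[symmetric] dyad_sum_mult_vector
    by (intro sum.cong) (auto simp: hinner_sum_orthonormal[OF assms])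
qed

lemma dyad_sum_diff: "dyad_sum k f u v - dyad_sum k g u v = dyad_sum k (\<lambda>j. f j - g j) u v"
  by (simp add: dyad_sum_def sum_subtractf[symmetric] scaleR_diff_left)

lemma spec_norm_dyad_sum_le:
  assumes u: "orthonormal_fam k u" and v: "orthonormal_fam k v"
    and C: "0 \<le> C" "\<And>j. j < k \<Longrightarrow> \<bar>f j\<bar> \<le> C"
  shows "spec_norm (dyad_sum k f u v) \<le> C"
proof (rule spec_norm_le)
  fix x
  have "(norm (dyad_sum k f u v *v x))\<^sup>2 = (\<Sum>j<k. (norm (of_real (f j) * hinner x (v j)))\<^sup>2)"
    unfolding dyad_sum_mult_vector by (rule norm_sum_orthonormal[OF u])
  also have "\<dots> \<le> (\<Sum>j<k. C\<^sup>2 * (norm (hinner x (v j)))\<^sup>2)"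
    using C by (intro sum_mono) (auto simp: norm_mult power_mult_distrib abs_le_square_iff[symmetric]
        intro!: mult_right_mono)
  also have "\<dots> \<le> C\<^sup>2 * (norm x)\<^sup>2"
    unfolding sum_distrib_left[symmetric] by (intro mult_left_mono bessel[OF v]) simp
  finally show "norm (dyad_sum k f u v *v x) \<le> C * norm x"
    unfolding power_mult_distrib[symmetric] by (rule power2_le_imp_le) (use C(1) in simp)
qed

lemma singular_value_pair:
  assumes "t \<in> singular_values G"
  obtains x y where "norm x = 1" "norm y = 1" "G *v x = t *\<^sub>R y" "hadjoint G *v y = t *\<^sub>R x" "0 \<le> t"
proof -
  obtain s u v j where svd: "is_svd G s u v" and j: "j < min CARD('b) CARD('a)" and t: "t = s j"
    using assms unfolding singular_values_def by auto
  let ?r = "min CARD('b) CARD('a)"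
  from svd have u: "orthonormal_fam ?r u" and v: "orthonormal_fam ?r v" and "0 \<le> t"
    and G: "G = dyad_sum ?r s u v"
    using j t by (auto simp: is_svd_def Let_def dyad_sum_def)
  have *: "dyad_sum ?r s a b *v (b j) = t *\<^sub>R a j" if "orthonormal_fam ?r b" for a b
  proof -
    have "dyad_sum ?r s a b *v (b j) = (\<Sum>i<?r. if i = j then t *\<^sub>R a j else 0)"
      unfolding dyad_sum_mult_vector using that j t
      by (intro sum.cong) (auto simp: orthonormal_famD of_real_scale)
    then show ?thesis using j by simp
  qed
  show ?thesis
  proof (rule that)
    show "G *v v j = t *\<^sub>R u j" unfolding G by (rule *[OF v])
    show "hadjoint G *v u j = t *\<^sub>R v j" unfolding G hadjoint_dyad_sum by (rule *[OF u])
  qed (use orthonormal_fam_norm[OF u] orthonormal_fam_norm[OF v] j \<open>0 \<le> t\<close> in auto)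
qed

section \<open>Truncated inverses and singular value gaps\<close>

text \<open>The Penrose conditions except \<open>G W G = G\<close>: \<open>W\<close> inverts a part \<open>G W G\<close> of \<open>G\<close>, and
  Hermitian products make \<open>G W\<close> and \<open>W G\<close> orthogonal projections.\<close>

definition outer_inverse :: "complex^'n^'m \<Rightarrow> complex^'m^'n \<Rightarrow> bool" where
  "outer_inverse G W \<longleftrightarrow>
     W ** G ** W = W \<and> hadjoint (G ** W) = G ** W \<and> hadjoint (W ** G) = W ** G"

text \<open>The singular values of \<open>G\<close> inverted by \<open>W\<close> are at least \<open>c\<close> and the remaining ones at most
  \<open>a\<close>. The bound \<open>\<parallel>W\<parallel> c \<le> 1\<close> also covers the case \<open>W = 0\<close>, where nothing is inverted.\<close>

definition singular_gap :: "complex^'n^'m \<Rightarrow> complex^'m^'n \<Rightarrow> real \<Rightarrow> real \<Rightarrow> bool" where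
  "singular_gap G W a c \<longleftrightarrow>
     outer_inverse G W \<and> 0 < c \<and> spec_norm W * c \<le> 1 \<and> spec_norm (G - G ** W ** G) \<le> a"

lemma singular_gapD:
  assumes "singular_gap G W a c"
  shows "outer_inverse G W" "0 < c" "spec_norm W * c \<le> 1" "spec_norm (G - G ** W ** G) \<le> a"
  using assms by (auto simp: singular_gap_def)

lemma singular_gap_nonneg: "singular_gap G W a c \<Longrightarrow> 0 \<le> a"
  using singular_gapD(4) spec_norm_nonneg order_trans by blast

lemma singular_gap_spec_norm_le: "singular_gap G W a c \<Longrightarrow> spec_norm W \<le> 1 / c"
  using singular_gapD(2,3)[of G W a c] by (simp add: pos_le_divide_eq)

text \<open>The witness inverts the singular values above \<open>t\<close> and maps the others to \<open>0\<close>.\<close>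

lemma svd_singular_gap_at:
  fixes G :: "complex^'n^'m"
  assumes svd: "is_svd G s u v" and t: "0 \<le> t" and a: "0 \<le> a" and c: "0 < c"
    and low: "\<And>j. j < min CARD('m) CARD('n) \<Longrightarrow> s j \<le> t \<Longrightarrow> s j \<le> a"
    and high: "\<And>j. j < min CARD('m) CARD('n) \<Longrightarrow> t < s j \<Longrightarrow> c \<le> s j"
  obtains W where "singular_gap G W a c"
    "G ** W ** G = (\<Sum>j | j < min CARD('m) CARD('n) \<and> s j > t. s j *\<^sub>R outer (u j) (v j))"
proof -
  let ?r = "min CARD('m) CARD('n)"
  from svd have u: "orthonormal_fam ?r u" and v: "orthonormal_fam ?r v"
    and s: "\<And>j. j < ?r \<Longrightarrow> 0 \<le> s j" and G: "G = dyad_sum ?r s u v"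
    by (auto simp: is_svd_def Let_def dyad_sum_def)
  define f where "f j = (if t < s j then 1 / s j else 0)" for j
  define W where "W = dyad_sum ?r f v u"
  note mult = dyad_sum_mult[OF u] dyad_sum_mult[OF v]
  have cong: "dyad_sum ?r g a b = dyad_sum ?r h a b" if "\<And>j. g j = h j" for g h a b
    using that by presburger
  have GW: "G ** W = dyad_sum ?r (\<lambda>j. s j * f j) u u"
    and WG: "W ** G = dyad_sum ?r (\<lambda>j. f j * s j) v v"
    unfolding G W_def mult by (rule refl)+
  have sf: "s j * f j = (if t < s j then 1 else 0)" for j
    using t by (simp add: f_def)
  have "W ** G ** W = dyad_sum ?r (\<lambda>j. f j * s j * f j) v u"
    unfolding WG unfolding W_def mult ..
  also have "\<dots> = W"
    unfolding W_def by (rule cong) (simp add: f_def)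
  finally have W: "outer_inverse G W"
    unfolding outer_inverse_def GW WG hadjoint_dyad_sum by simp
  have GWG: "G ** W ** G = dyad_sum ?r (\<lambda>j. if t < s j then s j else 0) u v"
    unfolding GW unfolding G mult by (rule cong) (simp add: sf)
  also have "\<dots> = (\<Sum>j | j < ?r \<and> s j > t. s j *\<^sub>R outer (u j) (v j))"
    unfolding dyad_sum_def by (rule sum.mono_neutral_cong_right) auto
  finally have sum: "G ** W ** G = (\<Sum>j | j < ?r \<and> s j > t. s j *\<^sub>R outer (u j) (v j))" .
  have "spec_norm W \<le> 1 / c"
    unfolding W_def
  proof (rule spec_norm_dyad_sum_le[OF v u])
    show "\<bar>f j\<bar> \<le> 1 / c" if "j < ?r" for j
      using c high[OF that] t by (auto simp: f_def intro: divide_left_mono)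
  qed (use c in simp)
  then have W_le: "spec_norm W * c \<le> 1" using c by (simp add: field_simps)
  have "spec_norm (G - G ** W ** G) \<le> a"
    unfolding GWG unfolding G dyad_sum_diff
    using a s low by (intro spec_norm_dyad_sum_le[OF u v]) (auto simp: not_less)
  then have "singular_gap G W a c"
    unfolding singular_gap_def using W c W_le by blast
  then show ?thesis using sum by (rule that)
qed

lemma finite_gap_above:
  fixes s :: "nat \<Rightarrow> real"
  obtains c where "t < c" "\<forall>j<r. t < s j \<longrightarrow> c \<le> s j"
proof
  \<comment> \<open>The value \<open>t + 1\<close> serves when no \<open>s j\<close> exceeds \<open>t\<close>.\<close>
  let ?c = "Min (insert (t + 1) (s ` {j. j < r \<and> t < s j}))"
  show "t < ?c" by auto
  show "\<forall>j<r. t < s j \<longrightarrow> ?c \<le> s j" by (auto intro!: Min_le)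
qed

lemma finite_gap_below:
  fixes s :: "nat \<Rightarrow> real"
  assumes "0 < t"
  obtains a where "0 \<le> a" "a < t" "\<forall>j<r. s j < t \<longrightarrow> s j \<le> a"
proof
  let ?a = "Max (insert 0 (s ` {j. j < r \<and> s j < t}))"
  show "0 \<le> ?a" by (auto intro: Max_ge)
  show "?a < t" using assms by auto
  show "\<forall>j<r. s j < t \<longrightarrow> s j \<le> ?a" by (auto intro!: Max_ge)
qed

section \<open>Orthogonal projections\<close>

definition orth_projection :: "complex^'n^'n \<Rightarrow> bool" where
  "orth_projection P \<longleftrightarrow> hadjoint P = P \<and> P ** P = P"

lemma orth_projection_complement:
  "orth_projection P \<Longrightarrow> orth_projection (mat 1 - P)"
  by (simp add: orth_projection_def hadjoint_diff matrix_diff_ldistrib matrix_diff_rdistrib)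

lemma orth_projection_orthogonal:
  assumes "orth_projection P"
  shows "hinner (P *v x) (y - P *v y) = 0"
proof -
  have "hinner (P *v x) (y - P *v y) = hinner x (P *v (y - P *v y))"
    using assms by (metis hinner_hadjoint_right orth_projection_def)
  also have "P *v (y - P *v y) = 0"
    using assms by (simp add: matrix_vector_mult_diff_distrib matrix_vector_mul_assoc orth_projection_def)
  finally show ?thesis by simp
qed

lemma orth_projection_pythagoras:
  assumes "orth_projection P"
  shows "(norm x)\<^sup>2 = (norm (P *v x))\<^sup>2 + (norm (x - P *v x))\<^sup>2"
  using pythagoras[OF orth_projection_orthogonal[OF assms, of x x]] by simp

lemma orth_projection_norm_le:
  assumes "orth_projection P"
  shows "norm (P *v x) \<le> norm x" "norm (x - P *v x) \<le> norm x"
  by (rule power2_le_imp_le; use orth_projection_pythagoras[OF assms, of x] in simp)+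

lemma spec_norm_orth_projection_le: "orth_projection P \<Longrightarrow> spec_norm P \<le> 1"
  by (rule spec_norm_le) (simp add: orth_projection_norm_le)

text \<open>The decomposition
  \<open>(P - P') x = (P - P' P) (P x) - (P' - P' P) (x - P x)\<close> has orthogonal summands, the first in the
  kernel and the second in the range of \<open>P'\<close>, and its arguments \<open>P x\<close> and \<open>x - P x\<close> are orthogonal
  too. Hence the two one-sided bounds combine without the factor 2 of the triangle inequality.\<close>

lemma spec_norm_orth_projection_diff_le:
  assumes P: "orth_projection P" and P': "orth_projection P'"
    and z: "spec_norm (P - P' ** P) \<le> z" "spec_norm (P' - P ** P') \<le> z"
  shows "spec_norm (P - P') \<le> z"
proof (rule spec_norm_le)
  fix x
  have z0: "0 \<le> z" using z(1) spec_norm_nonneg order_trans by blast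
  have "hadjoint (P' - P ** P') = P' - P' ** P"
    using P P' by (simp add: hadjoint_diff hadjoint_mult orth_projection_def)
  then have z': "spec_norm (P' - P' ** P) \<le> z"
    using z(2) spec_norm_hadjoint by metis
  have PP: "P ** P = P" "P *v (P *v x) = P *v x"
    using P by (simp_all add: matrix_vector_mul_assoc orth_projection_def)
  let ?y = "P *v x"
  let ?a = "(P - P' ** P) *v ?y" and ?b = "(P' - P' ** P) *v (x - ?y)"
  have "(P - P') *v x = ?a - ?b"
    by (simp add: matrix_vector_mult_diff_rdistrib matrix_vector_mult_diff_distrib PP
        matrix_vector_mul_assoc[symmetric])
  moreover have "hinner ?a (- ?b) = 0"
  proof -
    have "?a = ?y - P' *v ?y" "- ?b = P' *v (P *v (x - ?y) - (x - ?y))"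
      by (simp_all add: matrix_vector_mult_diff_rdistrib matrix_vector_mult_diff_distrib PP
        matrix_vector_mul_assoc[symmetric])
    then show ?thesis
      using orth_projection_orthogonal[OF P'] hinner_eq_zero_commute by metis
  qed
  ultimately have "(norm ((P - P') *v x))\<^sup>2 = (norm ?a)\<^sup>2 + (norm ?b)\<^sup>2"
    using pythagoras[of ?a "- ?b"] by simp
  also have "\<dots> \<le> (z * norm ?y)\<^sup>2 + (z * norm (x - ?y))\<^sup>2"
    using z(1) z' by (intro add_mono power_mono order_trans[OF norm_mult_le_spec_norm]
        mult_right_mono) auto
  also have "\<dots> = (z * norm x)\<^sup>2"
    unfolding power_mult_distrib orth_projection_pythagoras[OF P, of x] by (simp add: distrib_left)
  finally show "norm ((P - P') *v x) \<le> z * norm x"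
    by (rule power2_le_imp_le) (use z0 in simp)
qed

section \<open>The Moore--Penrose inverse\<close>

lemma outer_inverse_hadjoint: "outer_inverse G W \<Longrightarrow> outer_inverse (hadjoint G) (hadjoint W)"
  unfolding outer_inverse_def hadjoint_mult[symmetric] by (metis matrix_mul_assoc)

context
  fixes G :: "complex^'n^'m" and W :: "complex^'m^'n"
  assumes GW: "outer_inverse G W"
begin

lemma outer_inverse_WGW: "W ** (G ** W) = W"
  using GW by (simp add: outer_inverse_def matrix_mul_assoc)

lemma outer_inverse_WGWX: "W ** (G ** (W ** X)) = W ** X"
  by (metis outer_inverse_WGW matrix_mul_assoc)

lemma outer_inverse_projection_right: "orth_projection (G ** W)"
  using GW by (simp add: orth_projection_def outer_inverse_def matrix_mul_assoc[symmetric] outer_inverse_WGW)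

lemma outer_inverse_projection_left: "orth_projection (W ** G)"
  using GW by (simp add: orth_projection_def outer_inverse_def matrix_mul_assoc[symmetric] outer_inverse_WGWX)

end

text \<open>Both candidates give the same projections: \<open>G X\<close> and \<open>G Y\<close> absorb each other from the left,
  and taking adjoints of one absorption yields equality; likewise for \<open>X G\<close> and \<open>Y G\<close>.\<close>

lemma penrose_unique:
  assumes X: "G ** X ** G = G" "X ** G ** X = X" "hadjoint (G ** X) = G ** X" "hadjoint (X ** G) = X ** G"
    and Y: "G ** Y ** G = G" "Y ** G ** Y = Y" "hadjoint (G ** Y) = G ** Y" "hadjoint (Y ** G) = Y ** G"
  shows "X = Y"
proof -
  have "G ** X = (G ** Y) ** (G ** X)" by (metis matrix_mul_assoc Y(1))
  then have "G ** X = (G ** X) ** (G ** Y)" by (metis hadjoint_mult X(3) Y(3))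
  then have 1: "G ** X = G ** Y" by (metis matrix_mul_assoc X(1))
  have "X ** G = (X ** G) ** (Y ** G)" by (metis matrix_mul_assoc Y(1))
  then have "X ** G = (Y ** G) ** (X ** G)" by (metis hadjoint_mult X(4) Y(4))
  then have 2: "X ** G = Y ** G" by (metis matrix_mul_assoc X(1))
  show ?thesis by (metis 1 2 matrix_mul_assoc X(2) Y(2))
qed

lemma pinv_eqI:
  assumes "G ** X ** G = G" "outer_inverse G X"
  shows "pinv G = X"
  unfolding pinv_def
proof (rule the_equality)
  show X: "G ** X ** G = G \<and> X ** G ** X = X \<and> hadjoint (G ** X) = G ** X \<and> hadjoint (X ** G) = X ** G"
    using assms by (simp add: outer_inverse_def)
  show "Y = X" if "G ** Y ** G = G \<and> Y ** G ** Y = Y \<and>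
      hadjoint (G ** Y) = G ** Y \<and> hadjoint (Y ** G) = Y ** G" for Y
    by (rule penrose_unique[of G]) (simp_all only: that X)
qed

text \<open>An outer inverse of \<open>G\<close> satisfies the remaining Penrose condition for the part of \<open>G\<close> that it
  inverts.\<close>

lemma pinv_truncation:
  assumes "outer_inverse G W"
  shows "pinv (G ** W ** G) = W"
proof (rule pinv_eqI)
  note simps = matrix_mul_assoc[symmetric] outer_inverse_WGW[OF assms] outer_inverse_WGWX[OF assms]
  show "G ** W ** G ** W ** (G ** W ** G) = G ** W ** G" by (simp add: simps)
  have "hadjoint (G ** W) = G ** W" "hadjoint (W ** G) = W ** G"
    using assms by (auto simp: outer_inverse_def)
  then show "outer_inverse (G ** W ** G) W" by (simp add: outer_inverse_def simps)
qed

lemma pinv_outer_inverse: "outer_inverse G (pinv G)" "G ** pinv G ** G = G"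
proof -
  obtain s u v where svd: "is_svd G s u v" using svd_exists by blast
  obtain c where "0 < c" "\<forall>j<min CARD('b) CARD('a). 0 < s j \<longrightarrow> c \<le> s j"
    by (rule finite_gap_above)
  then obtain W where "singular_gap G W 0 c"
    using svd_singular_gap_at[OF svd order_refl order_refl] by blast
  then have W: "outer_inverse G W" and "spec_norm (G - G ** W ** G) = 0"
    using spec_norm_nonneg by (auto intro!: antisym dest: singular_gapD simp del: spec_norm_eq_zero)
  then have G: "G ** W ** G = G" by simp
  from pinv_eqI[OF this W] W G show "outer_inverse G (pinv G)" "G ** pinv G ** G = G"
    by auto
qed

section \<open>Perturbation of singular subspaces\<close>

text \<open>Write \<open>P = W A\<close>, \<open>Q = A W\<close>, and \<open>P'\<close>, \<open>Q'\<close> for the projections of \<open>B\<close>. The residuals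
  \<open>Y = Q - Q' Q\<close> and \<open>X = P - P' P\<close> satisfy \<open>Y A = (B - B W' B) X + (1 - Q') (A - B) P\<close>, and
  \<open>Y = Y A W\<close> recovers \<open>Y\<close> from \<open>Y A\<close> at the cost of \<open>\<parallel>W\<parallel> \<le> 1/c\<close>.\<close>

lemma sin_theta_one_sided:
  assumes W: "outer_inverse A W" and W': "outer_inverse B W'"
    and c: "0 < c" "spec_norm W * c \<le> 1" and a': "spec_norm (B - B ** W' ** B) \<le> a'"
  shows "c * spec_norm (A ** W - B ** W' ** (A ** W)) \<le>
    a' * spec_norm (W ** A - W' ** B ** (W ** A)) + spec_norm (A - B)"
proof -
  define Y where "Y = A ** W - B ** W' ** (A ** W)"
  define X where "X = W ** A - W' ** B ** (W ** A)"
  note simps = matrix_mul_assoc[symmetric] matrix_diff_ldistrib matrix_diff_rdistrib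
    outer_inverse_WGW[OF W] outer_inverse_WGWX[OF W] outer_inverse_WGW[OF W'] outer_inverse_WGWX[OF W']
  have P: "orth_projection (W ** A)" and Q': "orth_projection (B ** W')"
    using W W' by (auto intro: outer_inverse_projection_left outer_inverse_projection_right)
  have YA: "Y ** A = (B - B ** W' ** B) ** X + (mat 1 - B ** W') ** ((A - B) ** (W ** A))"
    unfolding X_def Y_def by (simp add: simps)
  have "spec_norm ((mat 1 - B ** W') ** ((A - B) ** (W ** A))) \<le>
      1 * (spec_norm (A - B) * 1)"
    by (intro order_trans[OF spec_norm_mult] mult_mono order_refl spec_norm_orth_projection_le
        orth_projection_complement P Q' mult_nonneg_nonneg) auto
  moreover have "spec_norm ((B - B ** W' ** B) ** X) \<le> a' * spec_norm X"
    by (intro order_trans[OF spec_norm_mult] mult_right_mono a') simp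
  ultimately have "spec_norm (Y ** A) \<le> a' * spec_norm X + spec_norm (A - B)"
    unfolding YA using spec_norm_triangle[of "(B - B ** W' ** B) ** X"
        "(mat 1 - B ** W') ** ((A - B) ** (W ** A))"] by linarith
  moreover have "c * spec_norm Y \<le> spec_norm (Y ** A)"
  proof -
    have "Y = Y ** A ** W" unfolding Y_def by (simp add: simps)
    then have "spec_norm Y \<le> spec_norm (Y ** A) * spec_norm W" by (metis spec_norm_mult)
    then have "c * spec_norm Y \<le> spec_norm (Y ** A) * (spec_norm W * c)"
      using c(1) by (simp add: mult.commute mult.left_commute)
    also have "\<dots> \<le> spec_norm (Y ** A) * 1"
      using c by (intro mult_left_mono) auto
    finally show ?thesis by simp
  qed
  ultimately show ?thesis unfolding X_def Y_def by linarith
qed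

text \<open>Passing to adjoints exchanges \<open>P\<close> with \<open>Q\<close>, so the one-sided estimate holds with the roles of
  the two residual norms \<open>x\<close> and \<open>y\<close> exchanged as well: \<open>c y \<le> a' x + e\<close> and \<open>c x \<le> a' y + e\<close>.
  The larger one is then at most \<open>e / (c - a')\<close>.\<close>

lemma sin_theta_one_sided_both:
  assumes W: "outer_inverse A W" and W': "outer_inverse B W'"
    and c: "0 < c" "spec_norm W * c \<le> 1" and a': "spec_norm (B - B ** W' ** B) \<le> a'"
    and \<gamma>: "0 < \<gamma>" "\<gamma> \<le> c - a'"
  shows "spec_norm (A ** W - B ** W' ** (A ** W)) \<le> spec_norm (A - B) / \<gamma>"
    and "spec_norm (W ** A - W' ** B ** (W ** A)) \<le> spec_norm (A - B) / \<gamma>"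
proof -
  define y where "y = spec_norm (A ** W - B ** W' ** (A ** W))"
  define x where "x = spec_norm (W ** A - W' ** B ** (W ** A))"
  define e where "e = spec_norm (A - B)"
  have 1: "c * y \<le> a' * x + e"
    unfolding x_def y_def e_def by (rule sin_theta_one_sided[OF W W' c a'])
  have adj: "hadjoint W ** hadjoint A = A ** W" "hadjoint A ** hadjoint W = W ** A"
    "hadjoint W' ** hadjoint B = B ** W'" "hadjoint B ** hadjoint W' = W' ** B"
    using W W' by (simp_all add: outer_inverse_def hadjoint_mult[symmetric])
  have "spec_norm (hadjoint B - hadjoint B ** hadjoint W' ** hadjoint B) \<le> a'"
    using a' spec_norm_hadjoint[of "B - B ** W' ** B"]
    by (simp add: hadjoint_diff hadjoint_mult matrix_mul_assoc)
  from sin_theta_one_sided[OF outer_inverse_hadjoint[OF W] outer_inverse_hadjoint[OF W'] c(1) _ this]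
  have 2: "c * x \<le> a' * y + e"
    using c(2) unfolding adj hadjoint_diff[symmetric] spec_norm_hadjoint x_def y_def e_def by simp
  have "0 \<le> a'" using a' spec_norm_nonneg order_trans by blast
  have "\<gamma> * max x y \<le> (c - a') * max x y"
    using \<gamma> by (intro mult_right_mono) (auto simp: x_def le_max_iff_disj)
  also have "\<dots> \<le> e"
  proof (cases "x \<le> y")
    case True
    then show ?thesis
      using 1 mult_left_mono[OF True \<open>0 \<le> a'\<close>] by (simp add: max_absorb2 left_diff_distrib)
  next
    case False
    then show ?thesis
      using 2 mult_left_mono[of y x a'] \<open>0 \<le> a'\<close> by (simp add: max_absorb1 left_diff_distrib)
  qed
  finally have "max x y \<le> e / \<gamma>"
    using \<gamma>(1) by (simp add: pos_le_divide_eq mult.commute del: max.bounded_iff)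
  then show "y \<le> e / \<gamma>" "x \<le> e / \<gamma>" by auto
qed

text \<open>The hypotheses are symmetric in \<open>A\<close> and \<open>B\<close>, so the one-sided bounds hold in both
  directions, and for orthogonal projections they combine without loss.\<close>

theorem sin_theta:
  assumes AW: "singular_gap A W a c" and BW': "singular_gap B W' a' c'"
    and \<gamma>: "0 < \<gamma>" "\<gamma> \<le> c - a'" "\<gamma> \<le> c' - a"
  shows "spec_norm (W ** A - W' ** B) \<le> spec_norm (A - B) / \<gamma>"
    and "spec_norm (A ** W - B ** W') \<le> spec_norm (A - B) / \<gamma>"
proof -
  note W = singular_gapD[OF AW] and W' = singular_gapD[OF BW']
  note AB = sin_theta_one_sided_both[OF W(1) W'(1) W(2,3) W'(4) \<gamma>(1,2)]
    and BA = sin_theta_one_sided_both[OF W'(1) W(1) W'(2,3) W(4) \<gamma>(1,3),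
      unfolded spec_norm_minus_commute[of B A]]
  show "spec_norm (W ** A - W' ** B) \<le> spec_norm (A - B) / \<gamma>"
    using outer_inverse_projection_left[OF W(1)] outer_inverse_projection_left[OF W'(1)] AB(2) BA(2)
    by (rule spec_norm_orth_projection_diff_le)
  show "spec_norm (A ** W - B ** W') \<le> spec_norm (A - B) / \<gamma>"
    using outer_inverse_projection_right[OF W(1)] outer_inverse_projection_right[OF W'(1)] AB(1) BA(1)
    by (rule spec_norm_orth_projection_diff_le)
qed

text \<open>Used to combine the estimates for a left and a right singular vector; the bound is for the
  Euclidean norm of the pair because only the sum of their squared components is controlled.\<close>

lemma planar_gap_bound:
  fixes c s p q r r' :: real
  assumes "c * p \<le> s * q + r" "c * q \<le> s * p + r'"
    and "0 \<le> c" "0 \<le> s" "0 \<le> p" "0 \<le> q"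
  shows "(c - s) * sqrt (p\<^sup>2 + q\<^sup>2) \<le> sqrt (r\<^sup>2 + r'\<^sup>2)"
proof -
  have "c * sqrt (p\<^sup>2 + q\<^sup>2) = sqrt ((c * p)\<^sup>2 + (c * q)\<^sup>2)"
    using assms by (simp add: power_mult_distrib distrib_left[symmetric] real_sqrt_mult)
  also have "\<dots> \<le> sqrt ((s * q + r)\<^sup>2 + (s * p + r')\<^sup>2)"
    using assms by (intro real_sqrt_le_mono add_mono power_mono) auto
  also have "\<dots> \<le> sqrt ((s * q)\<^sup>2 + (s * p)\<^sup>2) + sqrt (r\<^sup>2 + r'\<^sup>2)"
    by (rule real_sqrt_sum_squares_triangle_ineq)
  also have "sqrt ((s * q)\<^sup>2 + (s * p)\<^sup>2) = s * sqrt (p\<^sup>2 + q\<^sup>2)"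
    using assms by (simp add: power_mult_distrib distrib_left[symmetric] real_sqrt_mult add.commute)
  finally show ?thesis by (simp add: left_diff_distrib)
qed

text \<open>Here \<open>(x, y)\<close> is a singular pair of a perturbed matrix with singular value \<open>s\<close>, and \<open>d\<close> is the
  residual that it leaves in \<open>A\<close>. On the part inverted by \<open>W\<close> the matrix \<open>A\<close> stretches by at least
  \<open>c\<close>.\<close>

lemma singular_pair_inverted_part:
  fixes A :: "complex^'k^'l"
  assumes that: "outer_inverse A W" "spec_norm W * c \<le> 1" "A *v x = s *\<^sub>R y + d"
      "P = W ** A" "Q = A ** W"
    and c: "0 < c" and "0 \<le> s"
  shows "c * norm (P *v x) \<le> s * norm (Q *v y) + norm (Q *v d)"
proof -
  have "P *v x = W *v (Q *v (A *v x))"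
    using that(4,5)
    by (simp add: matrix_vector_mul_assoc matrix_mul_assoc[symmetric] outer_inverse_WGWX[OF that(1)])
  also have "\<dots> = W *v (s *\<^sub>R (Q *v y) + Q *v d)"
    unfolding that(3) by (simp add: matrix_vector_right_distrib matrix_vector_mult_scaleR_right)
  finally have "c * norm (P *v x) \<le> c * (spec_norm W * norm (s *\<^sub>R (Q *v y) + Q *v d))"
    using c norm_mult_le_spec_norm by (metis mult_left_mono less_imp_le)
  also have "\<dots> \<le> norm (s *\<^sub>R (Q *v y) + Q *v d)"
    using that(2) mult_right_mono[OF that(2), of "norm (s *\<^sub>R (Q *v y) + Q *v d)"]
    by (simp add: mult_ac)
  also have "\<dots> \<le> s * norm (Q *v y) + norm (Q *v d)"
    using norm_triangle_ineq[of "s *\<^sub>R (Q *v y)" "Q *v d"] \<open>0 \<le> s\<close> by simp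
  finally show ?thesis .
qed

text \<open>The complementary estimate: off the part inverted by \<open>W\<close> the matrix \<open>A\<close> stretches by at most
  \<open>a\<close>.\<close>

lemma singular_pair_residual_part:
  fixes A :: "complex^'k^'l"
  assumes that: "outer_inverse A W" "spec_norm (A - A ** W ** A) \<le> a" "A *v x = s *\<^sub>R y + d"
      "P = W ** A" "Q = A ** W"
    and "0 \<le> s"
  shows "s * norm (y - Q *v y) \<le> a * norm (x - P *v x) + norm (d - Q *v d)"
proof -
  have "(A - A ** W ** A) *v (x - P *v x) = A *v x - Q *v (A *v x)"
    using that(4,5)
    by (simp add: outer_inverse_WGWX[OF that(1)] matrix_vector_mul_assoc matrix_mul_assoc[symmetric]
        matrix_vector_mult_diff_distrib matrix_vector_mult_diff_rdistrib matrix_diff_rdistrib)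
  also have "\<dots> = s *\<^sub>R (y - Q *v y) + (d - Q *v d)"
    unfolding that(3) by (simp add: matrix_vector_right_distrib matrix_vector_mult_scaleR_right scaleR_diff_right)
  finally have "s *\<^sub>R (y - Q *v y) = (A - A ** W ** A) *v (x - P *v x) - (d - Q *v d)"
    by simp
  then have "norm (s *\<^sub>R (y - Q *v y)) \<le> norm ((A - A ** W ** A) *v (x - P *v x)) + norm (d - Q *v d)"
    using norm_triangle_ineq4 by metis
  also have "norm ((A - A ** W ** A) *v (x - P *v x)) \<le> a * norm (x - P *v x)"
    using norm_mult_le_spec_norm that(2) by (meson mult_right_mono norm_ge_zero order_trans)
  finally show ?thesis using \<open>0 \<le> s\<close> by simp
qed

text \<open>The singular value version of Weyl's theorem, with the sharp loss \<open>\<parallel>A - B\<parallel>\<close> at both ends of the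
  gap. Let \<open>(x, y)\<close> be a singular pair of \<open>B\<close> for \<open>s\<close>. It solves the equations for \<open>A\<close> up to
  residuals of norm at most \<open>e = \<parallel>A - B\<parallel>\<close>. Split the pair and the residuals by the projections of
  \<open>A\<close>: on one part the residual is at least \<open>c - s > e\<close> times the pair, on the other at least
  \<open>s - a > e\<close> times. By Pythagoras the squared residuals then add up to more than \<open>2 e\<^sup>2\<close>, a
  contradiction.\<close>

theorem no_singular_value_in_gap:
  assumes gap: "singular_gap A W a c"
    and s: "a + spec_norm (A - B) < s" "s < c - spec_norm (A - B)"
  shows "s \<notin> singular_values B"
proof
  note W = singular_gapD[OF gap]
  assume "s \<in> singular_values B"
  then obtain x y where xy: "norm x = 1" "norm y = 1" "B *v x = s *\<^sub>R y" "hadjoint B *v y = s *\<^sub>R x"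
    and "0 \<le> s" by (rule singular_value_pair)
  define e where "e = spec_norm (A - B)"
  define P where "P = W ** A"
  define Q where "Q = A ** W"
  have proj: "orth_projection P" "orth_projection Q"
    unfolding P_def Q_def using W(1) by (auto intro: outer_inverse_projection_left outer_inverse_projection_right)
  have adj: "hadjoint W ** hadjoint A = Q" "hadjoint A ** hadjoint W = P"
    using W(1) by (simp_all add: outer_inverse_def hadjoint_mult[symmetric] P_def Q_def)
  define d where "d = (A - B) *v x"
  define d' where "d' = hadjoint (A - B) *v y"
  have d: "norm d \<le> e" "norm d' \<le> e"
    using norm_mult_le_spec_norm[of "A - B" x] norm_mult_le_spec_norm[of "hadjoint (A - B)" y] xy
    by (simp_all only: d_def d'_def e_def spec_norm_hadjoint mult_1_right)
  have Ax: "A *v x = s *\<^sub>R y + d" and Ay: "hadjoint A *v y = s *\<^sub>R x + d'"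
    using xy by (simp_all add: d_def d'_def hadjoint_diff matrix_vector_mult_diff_rdistrib)
  have a: "0 \<le> a" using W(4) spec_norm_nonneg order_trans by blast
  have W_adj: "outer_inverse (hadjoint A) (hadjoint W)" "spec_norm (hadjoint W) * c \<le> 1"
    "spec_norm (hadjoint A - hadjoint A ** hadjoint W ** hadjoint A) \<le> a"
    using W spec_norm_hadjoint[of "A - A ** W ** A"]
    by (auto intro: outer_inverse_hadjoint simp: hadjoint_diff hadjoint_mult matrix_mul_assoc)
  define N1 where "N1 = (norm (P *v x))\<^sup>2 + (norm (Q *v y))\<^sup>2"
  define N2 where "N2 = (norm (x - P *v x))\<^sup>2 + (norm (y - Q *v y))\<^sup>2"
  define R1 where "R1 = (norm (Q *v d))\<^sup>2 + (norm (P *v d'))\<^sup>2"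
  define R2 where "R2 = (norm (d' - P *v d'))\<^sup>2 + (norm (d - Q *v d))\<^sup>2"
  have N: "N1 + N2 = 2" "0 \<le> N1" "0 \<le> N2"
    using orth_projection_pythagoras[OF proj(1), of x] orth_projection_pythagoras[OF proj(2), of y] xy
    by (auto simp: N1_def N2_def)
  have R: "R1 + R2 \<le> 2 * e\<^sup>2" "0 \<le> R1" "0 \<le> R2"
    using orth_projection_pythagoras[OF proj(1), of d'] orth_projection_pythagoras[OF proj(2), of d]
      power_mono[OF d(1), of 2] power_mono[OF d(2), of 2]
    by (auto simp: R1_def R2_def)
  have e: "0 \<le> e" by (simp add: e_def)
  have "(c - s) * sqrt N1 \<le> sqrt R1"
    unfolding N1_def R1_def
    by (rule planar_gap_bound)
      (use singular_pair_inverted_part[OF W(1,3) Ax P_def Q_def W(2) \<open>0 \<le> s\<close>]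
        singular_pair_inverted_part[OF W_adj(1,2) Ay adj(1)[symmetric] adj(2)[symmetric] W(2) \<open>0 \<le> s\<close>]
        W(2) \<open>0 \<le> s\<close> in auto)
  then have "((c - s) * sqrt N1)\<^sup>2 \<le> (sqrt R1)\<^sup>2"
    using s N by (intro power_mono) (auto simp: e_def[symmetric] e intro!: mult_nonneg_nonneg
        intro: order_trans[OF e])
  then have 1: "(c - s)\<^sup>2 * N1 \<le> R1" using N R by (simp add: power_mult_distrib)
  have "(s - a) * sqrt N2 \<le> sqrt R2"
    unfolding N2_def R2_def
    by (rule planar_gap_bound)
      (use singular_pair_residual_part[OF W(1,4) Ax P_def Q_def \<open>0 \<le> s\<close>]
        singular_pair_residual_part[OF W_adj(1,3) Ay adj(1)[symmetric] adj(2)[symmetric] \<open>0 \<le> s\<close>]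
        a \<open>0 \<le> s\<close> in auto)
  then have "((s - a) * sqrt N2)\<^sup>2 \<le> (sqrt R2)\<^sup>2"
    using s N by (intro power_mono) (auto simp: e_def[symmetric] e intro!: mult_nonneg_nonneg
        intro: order_trans[OF e])
  then have 2: "(s - a)\<^sup>2 * N2 \<le> R2" using N R by (simp add: power_mult_distrib)
  \<comment> \<open>Strictness survives because \<open>N1\<close> and \<open>N2\<close> are not both zero.\<close>
  have e1: "e\<^sup>2 < (c - s)\<^sup>2" and e2: "e\<^sup>2 < (s - a)\<^sup>2"
    using s e by (auto simp: e_def[symmetric] intro!: power_strict_mono)
  have "e\<^sup>2 * N1 + e\<^sup>2 * N2 < (c - s)\<^sup>2 * N1 + (s - a)\<^sup>2 * N2"
  proof (cases "N1 = 0")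
    case True
    then show ?thesis using N e2 by simp
  next
    case False
    then show ?thesis using N e1 e2 by (intro add_less_le_mono mult_strict_right_mono mult_right_mono) auto
  qed
  also have "\<dots> \<le> 2 * e\<^sup>2" using 1 2 R by linarith
  also have "2 * e\<^sup>2 = e\<^sup>2 * N1 + e\<^sup>2 * N2" using N by (metis distrib_left mult.commute)
  finally show False by simp
qed

section \<open>The theta-projection\<close>

text \<open>Each singular value of \<open>B\<close> lies below or above the shrunken gap, so truncating its singular
  value decomposition at any \<open>\<theta>\<close> inside the gap separates the two kinds.\<close>

lemma singular_gap_perturbed:
  fixes A B :: "complex^'n^'m"
  assumes gap: "singular_gap A W a c"
    and \<theta>: "a + spec_norm (A - B) < \<theta>" "\<theta> < c - spec_norm (A - B)"
  obtains W' where "singular_gap B W' (a + spec_norm (A - B)) (c - spec_norm (A - B))"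
proof -
  let ?e = "spec_norm (A - B)"
  have "0 \<le> a" by (rule singular_gap_nonneg[OF gap])
  then have \<theta>0: "0 \<le> \<theta>" and c0: "0 < c - ?e"
    using \<theta> spec_norm_nonneg[of "A - B"] by linarith+
  obtain s u v where svd: "is_svd B s u v" using svd_exists by blast
  have s: "s j \<le> a + ?e \<or> c - ?e \<le> s j" if "j < min CARD('m) CARD('n)" for j
  proof -
    have "s j \<in> singular_values B" using svd that unfolding singular_values_def by blast
    then show ?thesis using no_singular_value_in_gap[OF gap, of B "s j"] by linarith
  qed
  from \<open>0 \<le> a\<close> have "0 \<le> a + ?e" by simp
  then obtain W' where "singular_gap B W' (a + ?e) (c - ?e)"
  proof (rule svd_singular_gap_at[OF svd \<theta>0 _ c0])
    show "c - ?e \<le> s j" if "j < min CARD('m) CARD('n)" "\<theta> < s j" for j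
      using s[OF that(1)] that(2) \<theta>(1) by linarith
    show "s j \<le> a + ?e" if "j < min CARD('m) CARD('n)" "s j \<le> \<theta>" for j
      using s[OF that(1)] that(2) \<theta>(2) by linarith
  qed
  then show ?thesis by (rule that)
qed

lemma svd_singular_gap:
  fixes G :: "complex^'n^'m"
  assumes svd: "is_svd G s u v" and \<theta>: "0 < \<theta>" "\<theta> \<notin> singular_values G"
  obtains W a c where "singular_gap G W a c" "a < \<theta>" "\<theta> < c"
    "G ** W ** G = (\<Sum>j | j < min CARD('m) CARD('n) \<and> s j > \<theta>. s j *\<^sub>R outer (u j) (v j))"
proof -
  let ?r = "min CARD('m) CARD('n)"
  have s: "s j \<noteq> \<theta>" if "j < ?r" for j
    using svd that \<theta>(2) unfolding singular_values_def by blast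
  obtain a where a: "0 \<le> a" "a < \<theta>" "\<forall>j<?r. s j < \<theta> \<longrightarrow> s j \<le> a"
    by (rule finite_gap_below[OF \<theta>(1)])
  obtain c where c: "\<theta> < c" "\<forall>j<?r. \<theta> < s j \<longrightarrow> c \<le> s j"
    by (rule finite_gap_above)
  have "0 < c" using c \<theta>(1) by simp
  obtain W where "singular_gap G W a c"
    "G ** W ** G = (\<Sum>j | j < ?r \<and> s j > \<theta>. s j *\<^sub>R outer (u j) (v j))"
  proof (rule svd_singular_gap_at[OF svd less_imp_le[OF \<theta>(1)] a(1) \<open>0 < c\<close>])
    show "s j \<le> a" if "j < ?r" "s j \<le> \<theta>" for j
      using that s[OF that(1)] a(3) by force
    show "c \<le> s j" if "j < ?r" "\<theta> < s j" for j
      using that c(2) by blast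
  qed
  then show ?thesis using a(2) c(1) that by blast
qed

text \<open>The sine-theta theorem for a perturbation of norm \<open>0\<close>.\<close>

lemma singular_gap_truncation_unique:
  assumes "singular_gap G W a c" "a < \<theta>" "\<theta> < c" and "singular_gap G W' a' c'" "a' < \<theta>" "\<theta> < c'"
  shows "G ** W ** G = G ** W' ** G"
proof -
  have "spec_norm (G ** W - G ** W') \<le> spec_norm (G - G) / min (c - a') (c' - a)"
    using assms by (intro sin_theta(2)[OF assms(1,4)]) auto
  then have "spec_norm (G ** W - G ** W') = 0"
    by (intro antisym) simp_all
  then have "G ** W = G ** W'" by simp
  then show ?thesis by simp
qed

lemma gap_not_singular_value:
  assumes "singular_gap G W a c" "a < \<theta>" "\<theta> < c"
  shows "\<theta> \<notin> singular_values G"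
  using no_singular_value_in_gap[OF assms(1), of G \<theta>] assms(2,3) by simp

text \<open>The truncation at \<open>\<theta>\<close> of any singular value decomposition comes with a gap around \<open>\<theta>\<close>, hence
  all of them agree with the one determined by \<open>W\<close>.\<close>

lemma theta_proj_eq:
  assumes gap: "singular_gap G W a c" "a < \<theta>" "\<theta> < c"
  shows "theta_proj \<theta> G = G ** W ** G"
proof -
  let ?T = "\<lambda>s u v. \<Sum>j | j < min CARD('b) CARD('a) \<and> s j > \<theta>. s j *\<^sub>R outer (u j) (v j)"
  have \<theta>: "\<theta> \<notin> singular_values G" "0 < \<theta>"
    using gap_not_singular_value[OF gap] singular_gap_nonneg[OF gap(1)] gap(2) by auto
  have *: "?T s u v = G ** W ** G" if svd: "is_svd G s u v" for s u v
  proof -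
    obtain W' a' c' where W': "singular_gap G W' a' c'" "a' < \<theta>" "\<theta> < c'"
      and sum: "G ** W' ** G = ?T s u v"
      by (rule svd_singular_gap[OF svd \<theta>(2,1)])
    show ?thesis
      unfolding sum[symmetric] by (rule singular_gap_truncation_unique[OF W' gap])
  qed
  obtain s u v where svd: "is_svd G s u v" using svd_exists by blast
  have "(THE B. \<exists>s u v. is_svd G s u v \<and> B = ?T s u v) = G ** W ** G"
  proof (rule the_equality)
    show "\<exists>s u v. is_svd G s u v \<and> G ** W ** G = ?T s u v"
      using svd *[OF svd, symmetric] by blast
    show "B = G ** W ** G" if "\<exists>s u v. is_svd G s u v \<and> B = ?T s u v" for B
      using that * by (elim exE conjE) simp
  qed
  then show ?thesis unfolding theta_proj_def using \<theta>(1) by simp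
qed

lemma theta_rhs_eq:
  assumes gap: "singular_gap G W a c" "a < \<theta>" "\<theta> < c"
  shows "theta_rhs \<theta> G d = (G ** W) *v d"
proof -
  note W = singular_gapD(1)[OF gap(1)]
  have "G ** W ** G ** W = G ** W"
    by (simp add: matrix_mul_assoc[symmetric] outer_inverse_WGW[OF W])
  then show ?thesis
    unfolding theta_rhs_def theta_proj_eq[OF gap] pinv_truncation[OF W] by simp
qed

lemma backward_error_eq:
  assumes gap: "singular_gap G W a c" "a < \<theta>" "\<theta> < c"
  shows "backward_error \<theta> G d = pair_norm (G - G ** W ** G) (d - (G ** W) *v d)"
  by (simp only: backward_error_def theta_proj_eq[OF gap] theta_rhs_eq[OF gap])

text \<open>Applying \<open>W\<close> to \<open>G W G x = G W d\<close> loses nothing, since \<open>G\<close> recovers the equation.\<close>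

lemma sol_truncation:
  assumes W: "outer_inverse G W"
  shows "sol (G ** W ** G) ((G ** W) *v d) = {x. (W ** G) *v x = W *v d}"
proof -
  have "(G ** W ** G) *v x = (G ** W) *v d \<longleftrightarrow> (W ** G) *v x = W *v d" for x
  proof
    assume "(G ** W ** G) *v x = (G ** W) *v d"
    then have "W *v ((G ** W ** G) *v x) = W *v ((G ** W) *v d)" by simp
    then show "(W ** G) *v x = W *v d"
      by (simp add: matrix_vector_mul_assoc matrix_mul_assoc[symmetric] outer_inverse_WGW[OF W]
          outer_inverse_WGWX[OF W])
  next
    assume "(W ** G) *v x = W *v d"
    then have "G *v ((W ** G) *v x) = G *v (W *v d)" by simp
    then show "(G ** W ** G) *v x = (G ** W) *v d"
      by (simp add: matrix_vector_mul_assoc matrix_mul_assoc)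
  qed
  then show ?thesis by (simp add: sol_def)
qed

lemma sol_theta_eq:
  assumes gap: "singular_gap G W a c" "a < \<theta>" "\<theta> < c" and "backward_error \<theta> G d \<noteq> \<theta>"
  shows "sol_theta_defined \<theta> G d"
    and "sol_theta \<theta> G d = (if backward_error \<theta> G d < \<theta> then {x. (W ** G) *v x = W *v d} else {})"
proof -
  show "sol_theta_defined \<theta> G d"
    unfolding sol_theta_defined_def
    using gap_not_singular_value[OF gap] singular_gap_nonneg[OF gap(1)] gap(2) assms(4) by auto
  then show "sol_theta \<theta> G d = (if backward_error \<theta> G d < \<theta> then {x. (W ** G) *v x = W *v d} else {})"
    unfolding sol_theta_def theta_proj_eq[OF gap] theta_rhs_eq[OF gap]
      sol_truncation[OF singular_gapD(1)[OF gap(1)]] by simp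
qed

section \<open>Distances between solution sets\<close>

text \<open>A longest orthonormal family in \<open>V\<close> spans \<open>V\<close>, for otherwise a Gram--Schmidt step would extend
  it.\<close>

lemma orthonormal_basis_exists:
  fixes V :: "(complex^'n) set"
  assumes V: "vec.subspace V"
  shows "\<exists>k p. orthonormal_fam k p \<and> vec.span (p ` {..<k}) = V"
proof -
  let ?K = "{k. \<exists>p. orthonormal_fam k p \<and> p ` {..<k} \<subseteq> V}"
  have "?K \<subseteq> {..CARD('n)}" using orthonormal_fam_card_le by auto
  then have fin: "finite ?K" by (rule finite_subset) simp
  have "0 \<in> ?K" by (auto simp: orthonormal_fam_def)
  then have "Max ?K \<in> ?K" using fin by (intro Max_in) auto
  then obtain p where p: "orthonormal_fam (Max ?K) p" "p ` {..<Max ?K} \<subseteq> V" by auto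
  have "V \<subseteq> vec.span (p ` {..<Max ?K})"
  proof (rule ccontr)
    assume "\<not> ?thesis"
    then obtain x where "x \<in> V" "x \<notin> vec.span (p ` {..<Max ?K})" by auto
    then obtain y where y: "y \<in> V" "norm y = 1" "\<forall>i<Max ?K. hinner y (p i) = 0"
      by (rule orthonormal_fam_extend[OF p(1) V p(2)])
    have "orthonormal_fam (Suc (Max ?K)) (p(Max ?K := y))"
      by (rule orthonormal_fam_Suc[OF p(1) y(2,3)])
    moreover have "(p(Max ?K := y)) ` {..<Suc (Max ?K)} \<subseteq> V"
      using p(2) y(1) by (auto simp: less_Suc_eq)
    ultimately have "Suc (Max ?K) \<in> ?K" by blast
    then show False using Max_ge[OF fin] by fastforce
  qed
  then show ?thesis using p vec.span_minimal[OF p(2) V] by blast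
qed

text \<open>Each projection acts as the identity on the range of the other; taking the adjoint of
  \<open>M N = N\<close> and comparing with \<open>N M = M\<close> identifies them.\<close>

lemma orth_projection_eqI:
  fixes M N :: "complex^'n^'n"
  assumes "orth_projection M" "orth_projection N" and "{x. M *v x = x} = {x. N *v x = x}"
  shows "M = N"
proof -
  have fixed: "M ** N = N" if "orth_projection N" "{x. N *v x = x} \<subseteq> {x. M *v x = x}"
    for M N :: "complex^'n^'n"
  proof (rule matrix_eqI)
    fix x
    have "N *v (N *v x) = N *v x"
      using that(1) by (simp add: matrix_vector_mul_assoc orth_projection_def)
    then have "M *v (N *v x) = N *v x" using that(2) by blast
    then show "(M ** N) *v x = N *v x" by (simp add: matrix_vector_mul_assoc)
  qed
  have "M ** N = N" "N ** M = M" using assms by (auto intro!: fixed)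
  moreover have "hadjoint (M ** N) = N ** M"
    using assms by (simp add: hadjoint_mult orth_projection_def)
  ultimately show ?thesis using assms by (metis orth_projection_def)
qed

lemma vec_subspace_fixed: "vec.subspace {x. M *v x = x}" for M :: "complex^'n^'n"
  by (auto simp: vec.subspace_def matrix_vector_right_distrib matrix_vector_mult_scale)

lemma orth_proj_mat_fixed:
  fixes M :: "complex^'n^'n"
  assumes M: "orth_projection M"
  shows "orth_proj_mat {x. M *v x = x} = M"
proof -
  let ?V = "{x. M *v x = x}"
  have *: "(\<Sum>j<k. outer (p j) (p j)) = M"
    if p: "orthonormal_fam k p" and span: "vec.span (p ` {..<k}) = ?V" for k p
  proof -
    define N where "N = dyad_sum k (\<lambda>_. 1) p p"
    have N: "orth_projection N"
      by (simp add: orth_projection_def N_def hadjoint_dyad_sum dyad_sum_mult[OF p])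
    have Nx: "N *v x = (\<Sum>j<k. hinner x (p j) *s p j)" for x
      by (simp add: N_def dyad_sum_mult_vector)
    have "N *v x \<in> ?V" for x
      unfolding span[symmetric] Nx by (intro vec.span_sum vec.span_scale vec.span_base) auto
    then have "{x. N *v x = x} \<subseteq> ?V" by (metis (mono_tags) mem_Collect_eq subsetI)
    moreover have "?V \<subseteq> {x. N *v x = x}"
      unfolding span[symmetric]
    proof (rule vec.span_minimal)
      have "N *v p i = p i" if "i < k" for i
      proof -
        have "N *v p i = (\<Sum>j<k. if j = i then p j else 0)"
          unfolding Nx using that by (intro sum.cong) (auto simp: orthonormal_famD[OF p])
        then show ?thesis using that by simp
      qed
      then show "p ` {..<k} \<subseteq> {x. N *v x = x}" by auto
    qed (rule vec_subspace_fixed)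
    ultimately have "N = M" by (intro orth_projection_eqI N M) blast
    then show ?thesis by (simp add: N_def dyad_sum_def)
  qed
  obtain k p where kp: "orthonormal_fam k p" "vec.span (p ` {..<k}) = ?V"
    using orthonormal_basis_exists[OF vec_subspace_fixed] by blast
  show ?thesis
    unfolding orth_proj_mat_def
  proof (rule the_equality)
    show "\<exists>k p. orthonormal_fam k p \<and> vec.span (p ` {..<k}) = ?V \<and> M = (\<Sum>j<k. outer (p j) (p j))"
      using kp *[OF kp, symmetric] by blast
    show "N = M" if "\<exists>k p. orthonormal_fam k p \<and> vec.span (p ` {..<k}) = ?V \<and>
        N = (\<Sum>j<k. outer (p j) (p j))" for N
      using that * by (elim exE conjE) simp
  qed
qed

lemma orth_proj_mat_kernel:
  assumes "orth_projection P"
  shows "orth_proj_mat {x. P *v x = 0} = mat 1 - P"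
proof -
  have "{x. P *v x = 0} = {x. (mat 1 - P) *v x = x}"
    by (auto simp: matrix_vector_mult_diff_rdistrib)
  then show ?thesis
    using orth_proj_mat_fixed[OF orth_projection_complement[OF assms]] by simp
qed

text \<open>If \<open>x\<close> lies in the kernel of \<open>P'\<close> and is annihilated by \<open>1 - P\<close>, then \<open>x = (P - P') x\<close>, which forces
  \<open>x = 0\<close>. So \<open>1 - P\<close> embeds the kernel of \<open>P'\<close> into that of \<open>P\<close>.\<close>

lemma dim_kernel_le:
  fixes P P' :: "complex^'n^'n"
  assumes P: "orth_projection P" and close: "spec_norm (P - P') < 1"
  shows "vec.dim {x. P' *v x = 0} \<le> vec.dim {x. P *v x = 0}"
proof -
  let ?f = "(*v) (mat 1 - P)"
  have sub: "vec.subspace {x. P' *v x = 0}"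
    by (auto simp: vec.subspace_def matrix_vector_right_distrib matrix_vector_mult_scale)
  have zero: "x = 0" if "P' *v x = 0" "?f x = 0" for x
  proof (rule ccontr)
    assume "x \<noteq> 0"
    have "x = (P - P') *v x"
      using that by (simp add: matrix_vector_mult_diff_rdistrib)
    then have "norm x \<le> spec_norm (P - P') * norm x" by (metis norm_mult_le_spec_norm)
    also have "\<dots> < 1 * norm x" using close \<open>x \<noteq> 0\<close> by (intro mult_strict_right_mono) auto
    finally show False by simp
  qed
  have "inj_on ?f {x. P' *v x = 0}"
  proof (rule inj_onI)
    fix x y assume "x \<in> {x. P' *v x = 0}" "y \<in> {x. P' *v x = 0}" "?f x = ?f y"
    then have "P' *v (x - y) = 0" "?f (x - y) = 0"
      by (simp_all only: matrix_vector_mult_diff_distrib mem_Collect_eq diff_self)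
    then have "x - y = 0" by (rule zero)
    then show "x = y" by simp
  qed
  then have "vec.dim (?f ` {x. P' *v x = 0}) = vec.dim {x. P' *v x = 0}"
    using sub by (intro vec.dim_image_eq matrix_vector_mul_linear_gen) (simp add: vec.span_eq_iff[THEN iffD2])
  moreover have "?f ` {x. P' *v x = 0} \<subseteq> {x. P *v x = 0}"
    using P by (auto simp: matrix_vector_mul_assoc matrix_diff_ldistrib orth_projection_def)
  ultimately show ?thesis using vec.dim_subset by metis
qed

lemma direction_projection_fibre:
  assumes p: "P *v p = p"
  shows "direction {x. P *v x = p} = {x. P *v x = 0}"
proof (intro equalityI subsetI)
  fix v assume "v \<in> {x. P *v x = 0}"
  then have "v = (p + v) - p" "P *v (p + v) = p"
    using p by (simp_all add: matrix_vector_right_distrib)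
  then show "v \<in> direction {x. P *v x = p}" using p unfolding direction_def by blast
qed (auto simp: direction_def matrix_vector_mult_diff_distrib)

lemma min_norm_elt_projection_fibre:
  assumes P: "orth_projection P" and p: "P *v p = p"
  shows "min_norm_elt {x. P *v x = p} = p"
proof -
  have orth: "hinner p v = 0" if "P *v v = 0" for v
    using orth_projection_orthogonal[OF P, of p v] that p by simp
  show ?thesis
    unfolding min_norm_elt_def direction_projection_fibre[OF p]
  proof (rule the_equality)
    fix x assume x: "x \<in> {x. P *v x = p} \<and> (\<forall>v\<in>{x. P *v x = 0}. hinner x v = 0)"
    then have "P *v (x - p) = 0" using p by (simp add: matrix_vector_mult_diff_distrib)
    then have "hinner (x - p) (x - p) = 0" using x orth by (simp add: hinner_diff_left)
    then show "x = p" by simp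
  qed (use p orth in auto)
qed

lemma caffine_projection_fibre:
  assumes p: "P *v p = p"
  shows "caffine {x. P *v x = p}"
  unfolding caffine_def
proof (intro exI conjI)
  show "vec.subspace {x. P *v x = 0}"
    by (auto simp: vec.subspace_def matrix_vector_right_distrib matrix_vector_mult_scale)
  show "{x. P *v x = p} = (\<lambda>x. p + x) ` {x. P *v x = 0}"
  proof (intro equalityI subsetI)
    fix x assume "x \<in> {x. P *v x = p}"
    then have "x = p + (x - p)" "P *v (x - p) = 0"
      using p by (simp_all add: matrix_vector_mult_diff_distrib)
    then show "x \<in> (\<lambda>x. p + x) ` {x. P *v x = 0}" by blast
  qed (use p in \<open>auto simp: matrix_vector_right_distrib\<close>)
qed

text \<open>The solution sets of interest are fibres \<open>P x = p\<close> with \<open>P p = p\<close>: the direction is the kernel of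
  \<open>P\<close>, and \<open>p\<close> is orthogonal to it, hence the point of least norm. Closeness of \<open>P\<close> and \<open>P'\<close>
  provides the equality of dimensions.\<close>

lemma aff_dist_le_projection_fibres:
  assumes P: "orth_projection P" "P *v p = p" and P': "orth_projection P'" "P' *v p' = p'"
    and close: "spec_norm (P - P') < 1"
    and C: "spec_norm (P - P') \<le> C" "norm (p - p') \<le> C"
  shows "aff_dist_le {x. P *v x = p} {x. P' *v x = p'} C"
proof -
  have "p \<in> {x. P *v x = p}" using P by simp
  then have ne: "{x. P *v x = p} \<noteq> {}" by blast
  have "vec.dim {x. P *v x = 0} = vec.dim {x. P' *v x = 0}"
    using dim_kernel_le[OF P(1) close] dim_kernel_le[OF P'(1), of P] close
    by (simp add: spec_norm_minus_commute)
  moreover have "subspace_dist {x. P *v x = 0} {x. P' *v x = 0} = spec_norm (P - P')"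
    unfolding subspace_dist_def orth_proj_mat_kernel[OF P(1)] orth_proj_mat_kernel[OF P'(1)]
    by (simp add: spec_norm_minus_commute[of P])
  moreover have "aff_dist {x. P *v x = p} {x. P' *v x = p'} =
      max (norm (p - p')) (subspace_dist {x. P *v x = 0} {x. P' *v x = 0})"
    unfolding aff_dist_def using ne
    by (simp only: simp_thms if_False direction_projection_fibre min_norm_elt_projection_fibre P P')
  ultimately show ?thesis
    using C by (simp add: aff_dist_le_def aff_dist_defined_def caffine_projection_fibre P P'
        direction_projection_fibre)
qed

text \<open>An affine subspace is nonempty, so the distance to the empty set is defined for the empty set
  only.\<close>

lemma aff_dist_le_empty_iff: "aff_dist_le S {} C \<longleftrightarrow> S = {} \<and> 0 \<le> C"
proof -
  have "\<not> caffine {}" unfolding caffine_def using vec.subspace_0 by fastforce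
  then show ?thesis by (auto simp: aff_dist_le_def aff_dist_defined_def aff_dist_def)
qed

section \<open>Exact and perturbed solution sets\<close>

lemma norm_mult_le_of_spec_norm_le:
  "spec_norm M \<le> k \<Longrightarrow> norm x \<le> l \<Longrightarrow> norm (M *v x) \<le> k * l"
  by (rule order_trans[OF norm_mult_le_spec_norm], rule mult_mono)
    (auto intro: order_trans[OF spec_norm_nonneg])

lemma spec_norm_mult_le:
  "spec_norm M \<le> k \<Longrightarrow> spec_norm N \<le> l \<Longrightarrow> spec_norm (M ** N) \<le> k * l"
  by (rule order_trans[OF spec_norm_mult], rule mult_mono)
    (auto intro: order_trans[OF spec_norm_nonneg])

text \<open>The first and last summands vanish when the projections agree; the middle one is the familiar
  resolvent-type term of the invertible case.\<close>

lemma outer_inverse_diff: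
  assumes W: "outer_inverse A W" and W': "outer_inverse B W'"
  shows "W' - W = W' ** (B ** W' - A ** W) + W' ** ((A - B) ** W) + (W' ** B - W ** A) ** W"
  by (simp add: matrix_diff_ldistrib matrix_diff_rdistrib matrix_mul_assoc[symmetric]
      outer_inverse_WGW[OF W] outer_inverse_WGW[OF W'])

lemma spec_norm_outer_inverse_diff_le:
  assumes W: "outer_inverse A W" "spec_norm W \<le> k" and W': "outer_inverse B W'" "spec_norm W' \<le> k"
    and z: "spec_norm (W ** A - W' ** B) \<le> z" "spec_norm (A ** W - B ** W') \<le> z"
  shows "spec_norm (W' - W) \<le> 2 * k * z + k\<^sup>2 * spec_norm (A - B)"
proof -
  have "spec_norm (W' ** (B ** W' - A ** W)) \<le> k * z"
    using z by (intro spec_norm_mult_le W') (simp add: spec_norm_minus_commute)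
  moreover have "spec_norm (W' ** ((A - B) ** W)) \<le> k * (spec_norm (A - B) * k)"
    by (intro spec_norm_mult_le W W' order_refl)
  moreover have "spec_norm ((W' ** B - W ** A) ** W) \<le> z * k"
    using z by (intro spec_norm_mult_le W) (simp add: spec_norm_minus_commute)
  ultimately show ?thesis
    unfolding outer_inverse_diff[OF W(1) W'(1)]
    using spec_norm_triangle[of "W' ** (B ** W' - A ** W) + W' ** ((A - B) ** W)" "(W' ** B - W ** A) ** W"]
      spec_norm_triangle[of "W' ** (B ** W' - A ** W)" "W' ** ((A - B) ** W)"]
    by (simp add: power2_eq_square mult_ac)
qed

lemma singular_gap_pinv:
  assumes "A \<noteq> 0"
  shows "singular_gap A (pinv A) 0 (inverse (spec_norm (pinv A)))"
proof -
  have "pinv A \<noteq> 0"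
    using pinv_outer_inverse(2)[of A] assms by auto
  then have "0 < spec_norm (pinv A)"
    using spec_norm_nonneg[of "pinv A"] by (simp add: less_le)
  moreover from this have "spec_norm (pinv A) * inverse (spec_norm (pinv A)) = 1"
    by (intro right_inverse) linarith
  ultimately show ?thesis
    by (simp add: singular_gap_def pinv_outer_inverse)
qed

lemma pinv_range: "b \<in> range (\<lambda>x. A *v x) \<Longrightarrow> (A ** pinv A) *v b = b"
  by (auto simp: matrix_vector_mul_assoc pinv_outer_inverse)

lemma sol_eq_projection_fibre:
  assumes "b \<in> range (\<lambda>x. A *v x)"
  shows "sol A b = {x. (pinv A ** A) *v x = pinv A *v b}"
  using sol_truncation[OF pinv_outer_inverse(1), of A b]
  by (simp add: pinv_outer_inverse(2) pinv_range[OF assms])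

text \<open>Below the least positive singular value nothing but \<open>0\<close> is truncated, so the
  \<open>\<theta>\<close>-projection of \<open>A\<close> is \<open>A\<close> and the backward error is the distance from \<open>b\<close> to the range.\<close>

lemma sol_theta_exact:
  assumes A: "A \<noteq> 0" and \<theta>: "0 < \<theta>" "\<theta> < inverse (spec_norm (pinv A))"
    and b: "b \<in> range (\<lambda>x. A *v x) \<or> \<theta> < norm (b - (A ** pinv A) *v b)"
  shows "sol_theta_defined \<theta> A b \<and> sol A b = sol_theta \<theta> A b"
proof -
  note gap = singular_gap_pinv[OF A] \<theta>
  have error: "backward_error \<theta> A b = norm (b - (A ** pinv A) *v b)"
    by (simp add: backward_error_eq[OF gap] pinv_outer_inverse(2) pair_norm_def)
  show ?thesis
  proof (cases "b \<in> range (\<lambda>x. A *v x)")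
    case True
    then have "backward_error \<theta> A b < \<theta>" using error \<theta> pinv_range[OF True] by simp
    then show ?thesis
      using sol_theta_eq[OF gap, of b] sol_eq_projection_fibre[OF True] by simp
  next
    case False
    then have "sol A b = {}" by (auto simp: sol_def)
    then show ?thesis using sol_theta_eq[OF gap, of b] error b False by simp
  qed
qed

text \<open>The differences of the two residuals are
  \<open>(B - A) (1 - P') + A (P - P')\<close> and \<open>(1 - Q') (d - b) + (Q - Q') b\<close>, and orthogonal projections do
  not increase norms.\<close>

lemma backward_error_diff_le:
  assumes W: "outer_inverse A W" and W': "outer_inverse B W'"
    and z: "spec_norm (W ** A - W' ** B) \<le> z" "spec_norm (A ** W - B ** W') \<le> z"
  shows "\<bar>pair_norm (B - B ** W' ** B) (d - (B ** W') *v d) -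
      pair_norm (A - A ** W ** A) (b - (A ** W) *v b)\<bar> \<le>
    spec_norm (B - A) + norm (d - b) + (spec_norm A + norm b) * z"
proof -
  let ?M = "B - B ** W' ** B" and ?m = "d - (B ** W') *v d"
  let ?N = "A - A ** W ** A" and ?n = "b - (A ** W) *v b"
  have "?M - ?N = (B - A) ** (mat 1 - W' ** B) + A ** (W ** A - W' ** B)"
    by (simp add: matrix_diff_ldistrib matrix_diff_rdistrib matrix_mul_assoc[symmetric])
  moreover have "spec_norm ((B - A) ** (mat 1 - W' ** B)) \<le> spec_norm (B - A) * 1"
    by (intro spec_norm_mult_le order_refl spec_norm_orth_projection_le orth_projection_complement
        outer_inverse_projection_left W')
  moreover have "spec_norm (A ** (W ** A - W' ** B)) \<le> spec_norm A * z"
    by (intro spec_norm_mult_le order_refl z)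
  ultimately have M: "spec_norm (?M - ?N) \<le> spec_norm (B - A) + spec_norm A * z"
    using spec_norm_triangle[of "(B - A) ** (mat 1 - W' ** B)" "A ** (W ** A - W' ** B)"] by simp
  have m_eq: "?m - ?n = ((d - b) - (B ** W') *v (d - b)) + (A ** W - B ** W') *v b"
    by (simp add: matrix_vector_mult_diff_rdistrib matrix_vector_mult_diff_distrib)
  have "norm ((d - b) - (B ** W') *v (d - b)) \<le> norm (d - b)"
    by (intro orth_projection_norm_le outer_inverse_projection_right W')
  moreover have "norm ((A ** W - B ** W') *v b) \<le> z * norm b"
    by (intro norm_mult_le_of_spec_norm_le order_refl z)
  ultimately have m: "norm (?m - ?n) \<le> norm (d - b) + z * norm b"
    unfolding m_eq
    using norm_triangle_ineq[of "(d - b) - (B ** W') *v (d - b)" "(A ** W - B ** W') *v b"] by linarith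
  have "pair_norm (?M - ?N) (?m - ?n) \<le> spec_norm (B - A) + norm (d - b) + (spec_norm A + norm b) * z"
    using pair_norm_le_add[of "?M - ?N" "?m - ?n"] M m by (simp add: algebra_simps)
  moreover have "pair_norm ?M ?m \<le> pair_norm (?M - ?N) (?m - ?n) + pair_norm ?N ?n"
    using pair_norm_triangle[of "?M - ?N" ?N "?m - ?n" ?n] by simp
  moreover have "pair_norm ?N ?n \<le> pair_norm (?M - ?N) (?m - ?n) + pair_norm ?M ?m"
    using pair_norm_triangle[of "?N - ?M" ?M "?n - ?m" ?m]
    by (simp add: pair_norm_minus_commute[of ?M])
  ultimately show ?thesis by linarith
qed

text \<open>As \<open>\<theta>\<close> is not a singular value, it lies in a gap. The constant \<open>\<gamma>\<close> is half the distance from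
  \<open>\<theta>\<close> to the nearer end of the gap, so a perturbation smaller than \<open>\<gamma>\<close> keeps \<open>\<theta>\<close> inside the
  perturbed gap, leaves the sine-theta theorem a separation of at least \<open>\<gamma>\<close>, and makes its bound
  smaller than 1. Both truncated inverses have norm at most \<open>1/\<theta>\<close>, which gives the Lipschitz constant
  \<open>K\<close> for \<open>W\<close>; \<open>L\<close> is that of the backward error. Finally \<open>\<delta>\<close> is small enough for the backward error
  to stay on its side of \<open>\<theta>\<close>.\<close>

lemma sol_theta_lipschitz:
  fixes A :: "complex^'n^'m" and b :: "complex^'m"
  assumes def: "sol_theta_defined \<theta> A b"
  shows "\<exists>\<xi>>0. \<exists>\<delta>>0. \<forall>\<Delta>A \<Delta>b. pair_norm \<Delta>A \<Delta>b < \<delta> \<longrightarrow>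
    sol_theta_defined \<theta> (A + \<Delta>A) (b + \<Delta>b) \<and>
    aff_dist_le (sol_theta \<theta> (A + \<Delta>A) (b + \<Delta>b)) (sol_theta \<theta> A b) (\<xi> * pair_norm \<Delta>A \<Delta>b)"
proof -
  from def have \<theta>: "0 < \<theta>" "\<theta> \<notin> singular_values A" and error_ne: "backward_error \<theta> A b \<noteq> \<theta>"
    by (auto simp: sol_theta_defined_def)
  obtain s u v where svd: "is_svd A s u v" using svd_exists by blast
  obtain W a c where gap: "singular_gap A W a c" "a < \<theta>" "\<theta> < c"
    by (rule svd_singular_gap[OF svd \<theta>])
  define \<gamma> where "\<gamma> = min (c - \<theta>) (\<theta> - a) / 2"
  have \<gamma>: "0 < \<gamma>" "2 * \<gamma> \<le> c - \<theta>" "2 * \<gamma> \<le> \<theta> - a"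
    using gap by (auto simp: \<gamma>_def)
  define K where "K = 2 * (1 / \<theta>) / \<gamma> + (1 / \<theta>)\<^sup>2"
  define \<xi> where "\<xi> = 1 / \<gamma> + (1 / \<theta> + K * norm b)"
  define L where "L = 2 + (spec_norm A + norm b) / \<gamma>"
  define \<delta> where "\<delta> = min \<gamma> (\<bar>backward_error \<theta> A b - \<theta>\<bar> / L)"
  have K: "0 \<le> K" and L: "0 < L"
    using \<theta> \<gamma> by (auto simp: K_def L_def intro!: add_nonneg_nonneg divide_nonneg_pos add_pos_nonneg)
  have \<delta>: "0 < \<delta>" using \<gamma> L error_ne by (simp add: \<delta>_def)
  have \<xi>: "0 < \<xi>" using \<gamma> \<theta> K by (auto simp: \<xi>_def intro!: add_pos_nonneg)
  have main: "sol_theta_defined \<theta> (A + \<Delta>A) (b + \<Delta>b) \<and>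
      aff_dist_le (sol_theta \<theta> (A + \<Delta>A) (b + \<Delta>b)) (sol_theta \<theta> A b) (\<xi> * pair_norm \<Delta>A \<Delta>b)"
    if small: "pair_norm \<Delta>A \<Delta>b < \<delta>" for \<Delta>A \<Delta>b
  proof -
    define \<epsilon> where "\<epsilon> = pair_norm \<Delta>A \<Delta>b"
    define B where "B = A + \<Delta>A"
    define d where "d = b + \<Delta>b"
    have \<epsilon>: "0 \<le> \<epsilon>" "\<epsilon> < \<gamma>" using small by (auto simp: \<epsilon>_def \<delta>_def)
    have e: "spec_norm (A - B) \<le> \<epsilon>" "spec_norm (B - A) \<le> \<epsilon>" "norm (d - b) \<le> \<epsilon>"
      using spec_norm_le_pair_norm[of \<Delta>A \<Delta>b] norm_le_pair_norm[of \<Delta>b \<Delta>A]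
      by (simp_all add: B_def d_def \<epsilon>_def)
    obtain W' where gap': "singular_gap B W' (a + spec_norm (A - B)) (c - spec_norm (A - B))"
      by (rule singular_gap_perturbed[OF gap(1), of B \<theta>]) (use e \<epsilon> \<gamma> in linarith)+
    have \<theta>': "a + spec_norm (A - B) < \<theta>" "\<theta> < c - spec_norm (A - B)"
      using e \<epsilon> \<gamma> by linarith+
    note W = singular_gapD(1)[OF gap(1)] and W' = singular_gapD(1)[OF gap']
    have "spec_norm (A - B) / \<gamma> \<le> \<epsilon> / \<gamma>"
      using e \<gamma> by (simp add: divide_right_mono)
    moreover have "\<gamma> \<le> c - (a + spec_norm (A - B))" "\<gamma> \<le> c - spec_norm (A - B) - a"
      using e \<epsilon> \<gamma> by linarith+
    ultimately have proj: "spec_norm (W ** A - W' ** B) \<le> \<epsilon> / \<gamma>" "spec_norm (A ** W - B ** W') \<le> \<epsilon> / \<gamma>"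
      using sin_theta[OF gap(1) gap' \<gamma>(1)] by auto
    have k: "spec_norm W \<le> 1 / \<theta>" "spec_norm W' \<le> 1 / \<theta>"
      using singular_gap_spec_norm_le[OF gap(1)] singular_gap_spec_norm_le[OF gap'] \<theta>(1) gap(3) \<theta>'(2)
        divide_left_mono[of \<theta> c 1] divide_left_mono[of \<theta> "c - spec_norm (A - B)" 1]
      by (auto intro: order_trans)
    have "spec_norm (W' - W) \<le> 2 * (1 / \<theta>) * (\<epsilon> / \<gamma>) + (1 / \<theta>)\<^sup>2 * spec_norm (A - B)"
      by (rule spec_norm_outer_inverse_diff_le[OF W k(1) W' k(2) proj])
    also have "\<dots> \<le> 2 * (1 / \<theta>) * (\<epsilon> / \<gamma>) + (1 / \<theta>)\<^sup>2 * \<epsilon>"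
      using e by (intro add_left_mono mult_left_mono) auto
    also have "\<dots> = K * \<epsilon>" by (simp add: K_def algebra_simps)
    finally have W_diff: "spec_norm (W' - W) \<le> K * \<epsilon>" .
    have error: "\<bar>backward_error \<theta> B d - backward_error \<theta> A b\<bar> < \<bar>backward_error \<theta> A b - \<theta>\<bar>"
    proof -
      have "\<bar>backward_error \<theta> B d - backward_error \<theta> A b\<bar> \<le>
          spec_norm (B - A) + norm (d - b) + (spec_norm A + norm b) * (\<epsilon> / \<gamma>)"
        unfolding backward_error_eq[OF gap] backward_error_eq[OF gap' \<theta>']
        by (rule backward_error_diff_le[OF W W' proj])
      also have "\<dots> \<le> 2 * \<epsilon> + (spec_norm A + norm b) * (\<epsilon> / \<gamma>)"
        using e by linarith
      also have "\<dots> = L * \<epsilon>"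
        by (simp add: L_def distrib_right)
      also have "\<dots> < \<bar>backward_error \<theta> A b - \<theta>\<bar>"
        using small L by (simp add: \<delta>_def \<epsilon>_def pos_less_divide_eq mult.commute)
      finally show ?thesis .
    qed
    then have "backward_error \<theta> B d \<noteq> \<theta>" by auto
    note solB = sol_theta_eq[OF gap' \<theta>' this] and solA = sol_theta_eq[OF gap error_ne]
    have "aff_dist_le (sol_theta \<theta> B d) (sol_theta \<theta> A b) (\<xi> * \<epsilon>)"
    proof (cases "backward_error \<theta> A b < \<theta>")
      case True
      then have "backward_error \<theta> B d < \<theta>" using error by linarith
      moreover have "aff_dist_le {x. (W' ** B) *v x = W' *v d} {x. (W ** A) *v x = W *v b} (\<xi> * \<epsilon>)"
      proof (rule aff_dist_le_projection_fibres)
        show "orth_projection (W' ** B)" "orth_projection (W ** A)"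
          by (intro outer_inverse_projection_left W W')+
        show "(W' ** B) *v (W' *v d) = W' *v d" "(W ** A) *v (W *v b) = W *v b"
          using outer_inverse_WGW[OF W] outer_inverse_WGW[OF W']
          by (simp_all add: matrix_vector_mul_assoc matrix_mul_assoc)
        have P: "spec_norm (W' ** B - W ** A) \<le> \<epsilon> / \<gamma>"
          using proj(1) by (simp add: spec_norm_minus_commute)
        also have "\<dots> < 1" using \<epsilon> \<gamma> by simp
        finally show "spec_norm (W' ** B - W ** A) < 1" .
        have "0 \<le> (1 / \<theta> + K * norm b) * \<epsilon>" using \<theta> K \<epsilon> by simp
        then show "spec_norm (W' ** B - W ** A) \<le> \<xi> * \<epsilon>"
          using P by (simp add: \<xi>_def distrib_right)
        have diff: "W' *v d - W *v b = W' *v (d - b) + (W' - W) *v b"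
          by (simp add: matrix_vector_mult_diff_rdistrib matrix_vector_mult_diff_distrib)
        have "norm (W' *v (d - b)) \<le> 1 / \<theta> * \<epsilon>"
          by (rule norm_mult_le_of_spec_norm_le[OF k(2) e(3)])
        moreover have "norm ((W' - W) *v b) \<le> K * \<epsilon> * norm b"
          by (rule norm_mult_le_of_spec_norm_le[OF W_diff order_refl])
        ultimately have "norm (W' *v d - W *v b) \<le> 1 / \<theta> * \<epsilon> + K * \<epsilon> * norm b"
          unfolding diff using norm_triangle_ineq[of "W' *v (d - b)" "(W' - W) *v b"] by linarith
        also have "\<dots> \<le> \<xi> * \<epsilon>"
          using \<gamma>(1) \<epsilon>(1) by (simp add: \<xi>_def algebra_simps)
        finally show "norm (W' *v d - W *v b) \<le> \<xi> * \<epsilon>" .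
      qed
      ultimately show ?thesis using True solA solB by simp
    next
      case False
      then have "\<not> backward_error \<theta> B d < \<theta>" using error by linarith
      then show ?thesis using False solA solB \<xi> \<epsilon> by (simp add: aff_dist_le_empty_iff)
    qed
    then show ?thesis using solB(1) by (simp add: B_def d_def \<epsilon>_def)
  qed
  then show ?thesis using \<xi> \<delta> by blast
qed

text \<open>Since \<open>b = A x\<close> with \<open>x\<close> of least norm, \<open>b = B x - \<Delta>A x\<close> for the perturbed matrix \<open>B\<close>. The
  singular values of \<open>A\<close> are \<open>0\<close> or at least \<open>\<sigma> = 1 / \<parallel>A\<^sup>\<dagger>\<parallel>\<close>; those of \<open>B\<close> are therefore at most
  \<open>e = \<parallel>\<Delta>A\<parallel>\<close> or at least \<open>\<sigma> - e\<close>, with \<open>\<theta>\<close> in between. Hence the part of \<open>B\<close> dropped has norm at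
  most \<open>e\<close>, and with \<open>g = 1 / (\<sigma> - e)\<close> one has \<open>\<parallel>W'\<parallel> \<le> g\<close> and
  \<open>\<parallel>P' - P\<parallel> \<le> e g\<close>. The forward error is
  \<open>W' d - x = W' (\<Delta>b - \<Delta>A x) - (x - P' x)\<close>, a sum of vectors in the range and in the kernel of \<open>P'\<close>
  whose norms are at most \<open>g (\<parallel>\<Delta>b\<parallel> + e \<parallel>x\<parallel>)\<close> and \<open>e g \<parallel>x\<parallel>\<close>. The common factor \<open>g\<close> equals
  \<open>\<parallel>A\<parallel> \<parallel>A\<^sup>\<dagger>\<parallel> / (\<parallel>A\<parallel> - \<parallel>A\<parallel> \<parallel>A\<^sup>\<dagger>\<parallel> e)\<close>.\<close>

lemma sol_theta_consistent:
  fixes A :: "complex^'n^'m" and b :: "complex^'m"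
  assumes A: "A \<noteq> 0" and b: "b \<in> range (\<lambda>x. A *v x)"
    and \<theta>: "sqrt (4 * (spec_norm (pinv A))\<^sup>2 * (norm b)\<^sup>2 + 2) * pair_norm \<Delta>A \<Delta>b < \<theta>"
      "\<theta> < inverse (spec_norm (pinv A)) - pair_norm \<Delta>A \<Delta>b"
  shows "sol_theta_defined \<theta> (A + \<Delta>A) (b + \<Delta>b)"
    and "backward_error \<theta> (A + \<Delta>A) (b + \<Delta>b) \<le>
      sqrt (4 * (spec_norm (pinv A))\<^sup>2 * (norm b)\<^sup>2 + 2) * pair_norm \<Delta>A \<Delta>b"
    and "aff_dist_le (sol_theta \<theta> (A + \<Delta>A) (b + \<Delta>b)) (sol A b)
      (spec_norm A * spec_norm (pinv A) *
        (sqrt (4 * (norm (pinv A *v b))\<^sup>2 + 1) /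
          (spec_norm A - spec_norm A * spec_norm (pinv A) * spec_norm \<Delta>A)) *
        pair_norm \<Delta>A \<Delta>b)"
proof -
  define B where "B = A + \<Delta>A"
  define d where "d = b + \<Delta>b"
  define W where "W = pinv A"
  define x where "x = W *v b"
  define \<kappa> where "\<kappa> = spec_norm W"
  define \<sigma> where "\<sigma> = inverse \<kappa>"
  define e where "e = spec_norm \<Delta>A"
  define \<epsilon> where "\<epsilon> = pair_norm \<Delta>A \<Delta>b"
  define t where "t = \<kappa> * norm b"
  define \<omega> where "\<omega> = sqrt (4 * \<kappa>\<^sup>2 * (norm b)\<^sup>2 + 2)"
  have gap: "singular_gap A W 0 \<sigma>"
    unfolding W_def \<sigma>_def \<kappa>_def by (rule singular_gap_pinv[OF A])
  have \<sigma>: "0 < \<sigma>" by (rule singular_gapD(2)[OF gap])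
  then have \<kappa>: "0 < \<kappa>" by (simp add: \<sigma>_def)
  have \<epsilon>: "0 \<le> \<epsilon>" "0 \<le> e" "e \<le> \<epsilon>" and \<epsilon>2: "\<epsilon>\<^sup>2 = e\<^sup>2 + (norm \<Delta>b)\<^sup>2"
    by (simp_all add: \<epsilon>_def e_def spec_norm_le_pair_norm pair_norm_def)
  have \<omega>: "1 \<le> \<omega>" "\<omega>\<^sup>2 = 4 * t\<^sup>2 + 2"
    by (simp_all add: \<omega>_def t_def power_mult_distrib real_le_rsqrt)
  have \<theta>1: "\<omega> * \<epsilon> < \<theta>" "\<theta> < \<sigma> - \<epsilon>"
    using \<theta> by (simp_all add: \<omega>_def \<epsilon>_def \<sigma>_def \<kappa>_def W_def)
  have "1 * \<epsilon> \<le> \<omega> * \<epsilon>" using \<omega> \<epsilon> by (intro mult_right_mono)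
  with \<theta>1 have e_small: "e < \<theta>" "\<theta> < \<sigma> - e" "e < \<sigma> - e"
    using \<epsilon> by linarith+
  have e_diff: "spec_norm (A - B) = e" by (simp add: B_def e_def)
  obtain W' where gap': "singular_gap B W' (0 + e) (\<sigma> - e)"
    by (rule singular_gap_perturbed[OF gap, of B \<theta>, unfolded e_diff]) (use e_small in auto)
  have \<theta>': "0 + e < \<theta>" "\<theta> < \<sigma> - e" using e_small by auto
  note W = singular_gapD(1)[OF gap] and W' = singular_gapD(1)[OF gap']
  define g where "g = 1 / (\<sigma> - e)"
  have g: "0 \<le> g" using e_small \<epsilon> by (simp add: g_def)
  have W'_le: "spec_norm W' \<le> g"
    unfolding g_def by (rule singular_gap_spec_norm_le[OF gap'])
  have "spec_norm (W ** A - W' ** B) \<le> e / (\<sigma> - e)"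
    using sin_theta(1)[OF gap gap', of "\<sigma> - e"] e_small \<epsilon> by (simp add: e_diff)
  then have proj: "spec_norm (W' ** B - W ** A) \<le> e * g"
    by (simp add: g_def spec_norm_minus_commute)
  have "(A ** W) *v b = b" unfolding W_def by (rule pinv_range[OF b])
  then have "A *v x = b" by (simp add: x_def matrix_vector_mul_assoc)
  then have b_eq: "b = B *v x - \<Delta>A *v x"
    by (simp add: B_def matrix_vector_mult_add_rdistrib)
  have Px: "(W ** A) *v x = x"
    using outer_inverse_WGW[OF W] by (simp add: x_def matrix_vector_mul_assoc matrix_mul_assoc)
  have \<Delta>Ax: "norm (\<Delta>A *v x) \<le> e * norm x" unfolding e_def by (rule norm_mult_le_spec_norm)
  have Q': "orth_projection (B ** W')" and P': "orth_projection (W' ** B)"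
    by (rule outer_inverse_projection_right[OF W'], rule outer_inverse_projection_left[OF W'])
  have "backward_error \<theta> B d \<le> \<omega> * \<epsilon>"
  proof -
    \<comment> \<open>\<open>b\<close> leaves two residuals of norm at most \<open>e \<parallel>x\<parallel>\<close>, one from the dropped part of \<open>B\<close> and one
      from \<open>\<Delta>A\<close>; this is the origin of the factor 4 in \<open>\<omega>\<close>.\<close>
    have "d - (B ** W') *v d = ((B - B ** W' ** B) *v x - (\<Delta>A *v x - (B ** W') *v (\<Delta>A *v x))) +
        (\<Delta>b - (B ** W') *v \<Delta>b)"
      unfolding d_def b_eq
      by (simp add: matrix_vector_right_distrib matrix_vector_mult_diff_distrib
          matrix_vector_mult_diff_rdistrib matrix_vector_mul_assoc)
    moreover have "norm ((B - B ** W' ** B) *v x) \<le> e * norm x"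
      using singular_gapD(4)[OF gap'] by (intro norm_mult_le_of_spec_norm_le) auto
    moreover have "norm (\<Delta>A *v x - (B ** W') *v (\<Delta>A *v x)) \<le> e * norm x"
      using orth_projection_norm_le(2)[OF Q'] \<Delta>Ax by (rule order_trans)
    moreover have "norm (\<Delta>b - (B ** W') *v \<Delta>b) \<le> norm \<Delta>b"
      by (rule orth_projection_norm_le(2)[OF Q'])
    moreover have "e * norm x \<le> e * t"
      unfolding x_def t_def \<kappa>_def by (intro mult_left_mono norm_mult_le_spec_norm \<epsilon>)
    ultimately have r: "norm (d - (B ** W') *v d) \<le> 2 * (e * t) + norm \<Delta>b"
      using norm_triangle_ineq[of "(B - B ** W' ** B) *v x - (\<Delta>A *v x - (B ** W') *v (\<Delta>A *v x))"
          "\<Delta>b - (B ** W') *v \<Delta>b"]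
        norm_triangle_ineq4[of "(B - B ** W' ** B) *v x" "\<Delta>A *v x - (B ** W') *v (\<Delta>A *v x)"]
      by simp
    have "(spec_norm (B - B ** W' ** B))\<^sup>2 + (norm (d - (B ** W') *v d))\<^sup>2 \<le>
        e\<^sup>2 + (2 * (e * t) + norm \<Delta>b)\<^sup>2"
      using singular_gapD(4)[OF gap'] r by (intro add_mono power_mono) auto
    also have "\<dots> \<le> (\<omega> * \<epsilon>)\<^sup>2"
    proof -
      \<comment> \<open>The required inequality, with its defect written as a sum of squares.\<close>
      have "(\<omega> * \<epsilon>)\<^sup>2 - (e\<^sup>2 + (2 * (e * t) + norm \<Delta>b)\<^sup>2) =
          (2 * t * norm \<Delta>b - e)\<^sup>2 + (norm \<Delta>b)\<^sup>2"
        unfolding power_mult_distrib[of \<omega>] \<omega> \<epsilon>2 by (simp add: power2_eq_square algebra_simps)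
      also have "0 \<le> \<dots>" by simp
      finally show ?thesis by simp
    qed
    finally show ?thesis
      unfolding backward_error_eq[OF gap' \<theta>'] pair_norm_def
      using \<omega> \<epsilon> by (intro real_le_lsqrt) auto
  qed
  then have error: "backward_error \<theta> B d \<le> \<omega> * \<epsilon>" "backward_error \<theta> B d < \<theta>"
    using \<theta>1 by auto
  note solB = sol_theta_eq[OF gap' \<theta>' less_imp_neq[OF error(2)]]
  define \<eta> where "\<eta> = sqrt (4 * (norm x)\<^sup>2 + 1)"
  have \<eta>: "1 \<le> \<eta>" "\<eta>\<^sup>2 = 4 * (norm x)\<^sup>2 + 1"
    by (simp_all add: \<eta>_def real_le_rsqrt)
  have "aff_dist_le {y. (W' ** B) *v y = W' *v d} {y. (W ** A) *v y = W *v b} (\<eta> * \<epsilon> * g)"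
  proof (rule aff_dist_le_projection_fibres)
    show "orth_projection (W' ** B)" "orth_projection (W ** A)"
      by (intro outer_inverse_projection_left W W')+
    show P'd: "(W' ** B) *v (W' *v d) = W' *v d"
      using outer_inverse_WGW[OF W'] by (simp add: matrix_vector_mul_assoc matrix_mul_assoc)
    show "(W ** A) *v (W *v b) = W *v b" using Px by (simp add: x_def)
    have "e * g < 1" using e_small \<epsilon> by (simp add: g_def)
    then show "spec_norm (W' ** B - W ** A) < 1" using proj by linarith
    have "1 * e * g \<le> \<eta> * \<epsilon> * g"
      using \<eta> \<epsilon> g by (intro mult_right_mono mult_mono) auto
    then show "spec_norm (W' ** B - W ** A) \<le> \<eta> * \<epsilon> * g" using proj by simp
    define z where "z = W' *v (\<Delta>b - \<Delta>A *v x)"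
    have "W' *v d = (W' ** B) *v x + z"
      unfolding d_def b_eq z_def
      by (simp add: matrix_vector_right_distrib matrix_vector_mult_diff_distrib matrix_vector_mul_assoc)
    then have split: "W' *v d - W *v b = z + (- (x - (W' ** B) *v x))"
      by (simp add: x_def)
    have "(W' ** B) *v z = z"
      using outer_inverse_WGW[OF W'] by (simp add: z_def matrix_vector_mul_assoc matrix_mul_assoc)
    then have "hinner z (x - (W' ** B) *v x) = 0"
      using orth_projection_orthogonal[OF P', of z x] by simp
    then have "hinner z (- (x - (W' ** B) *v x)) = 0"
      using hinner_diff_right[of z 0 "x - (W' ** B) *v x"] by simp
    then have "(norm (W' *v d - W *v b))\<^sup>2 = (norm z)\<^sup>2 + (norm (x - (W' ** B) *v x))\<^sup>2"
      unfolding split by (subst pythagoras) (simp_all only: norm_minus_cancel)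
    also have "\<dots> \<le> (g * (norm \<Delta>b + e * norm x))\<^sup>2 + (e * g * norm x)\<^sup>2"
    proof (intro add_mono power_mono)
      have "norm (\<Delta>b - \<Delta>A *v x) \<le> norm \<Delta>b + e * norm x"
        using norm_triangle_ineq4[of \<Delta>b "\<Delta>A *v x"] \<Delta>Ax by linarith
      then show "norm z \<le> g * (norm \<Delta>b + e * norm x)"
        unfolding z_def by (rule norm_mult_le_of_spec_norm_le[OF W'_le])
      have "x - (W' ** B) *v x = (W ** A - W' ** B) *v x"
        by (simp add: matrix_vector_mult_diff_rdistrib Px)
      then show "norm (x - (W' ** B) *v x) \<le> e * g * norm x"
        using norm_mult_le_of_spec_norm_le[of "W ** A - W' ** B" "e * g" x "norm x"] proj
        by (simp add: spec_norm_minus_commute)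
    qed auto
    also have "\<dots> \<le> (\<eta> * \<epsilon> * g)\<^sup>2"
    proof -
      have "(\<eta> * \<epsilon> * g)\<^sup>2 - ((g * (norm \<Delta>b + e * norm x))\<^sup>2 + (e * g * norm x)\<^sup>2) =
          g\<^sup>2 * ((e - norm \<Delta>b * norm x)\<^sup>2 + 3 * (norm x * norm \<Delta>b)\<^sup>2 + 2 * (norm x * e)\<^sup>2)"
        unfolding power_mult_distrib[of _ g] power_mult_distrib[of \<eta>] \<eta> \<epsilon>2
        by (simp add: power2_eq_square algebra_simps)
      also have "0 \<le> \<dots>" by (intro mult_nonneg_nonneg add_nonneg_nonneg) auto
      finally show ?thesis by simp
    qed
    finally show "norm (W' *v d - W *v b) \<le> \<eta> * \<epsilon> * g"
      by (rule power2_le_imp_le) (use \<eta> \<epsilon> g in auto)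
  qed
  moreover have "\<eta> * \<epsilon> * g = spec_norm A * \<kappa> * (\<eta> / (spec_norm A - spec_norm A * \<kappa> * e)) * \<epsilon>"
  proof -
    have "\<kappa> * e < 1" using e_small \<epsilon> \<kappa> by (simp add: \<sigma>_def field_simps)
    then have "g = \<kappa> / (1 - \<kappa> * e)"
      using \<kappa> by (simp add: g_def \<sigma>_def field_simps)
    moreover have "spec_norm A - spec_norm A * \<kappa> * e = spec_norm A * (1 - \<kappa> * e)"
      by (simp add: algebra_simps)
    ultimately show ?thesis using A by (simp add: mult_ac)
  qed
  ultimately have dist: "aff_dist_le (sol_theta \<theta> B d) (sol A b)
      (spec_norm A * \<kappa> * (\<eta> / (spec_norm A - spec_norm A * \<kappa> * e)) * \<epsilon>)"
    using solB(2) error(2) sol_eq_projection_fibre[OF b] by (simp add: W_def)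
  show "sol_theta_defined \<theta> (A + \<Delta>A) (b + \<Delta>b)"
    using solB(1) by (simp add: B_def d_def)
  show "backward_error \<theta> (A + \<Delta>A) (b + \<Delta>b) \<le>
      sqrt (4 * (spec_norm (pinv A))\<^sup>2 * (norm b)\<^sup>2 + 2) * pair_norm \<Delta>A \<Delta>b"
    using error(1) by (simp add: B_def d_def \<omega>_def \<kappa>_def W_def \<epsilon>_def)
  show "aff_dist_le (sol_theta \<theta> (A + \<Delta>A) (b + \<Delta>b)) (sol A b)
      (spec_norm A * spec_norm (pinv A) *
        (sqrt (4 * (norm (pinv A *v b))\<^sup>2 + 1) /
          (spec_norm A - spec_norm A * spec_norm (pinv A) * spec_norm \<Delta>A)) *
        pair_norm \<Delta>A \<Delta>b)"
    using dist by (simp add: B_def d_def \<eta>_def x_def \<kappa>_def W_def \<epsilon>_def e_def)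
qed

section \<open>Existence, uniqueness and regularity of the general numerical solution\<close>

theorem theorem3:
  fixes A :: "complex^'n^'m" and b :: "complex^'m"
  shows
    "(A \<noteq> 0 \<longrightarrow>
        (b \<in> range (\<lambda>x. A *v x) \<longrightarrow>
           (\<forall>\<theta>. 0 < \<theta> \<and> \<theta> < inverse (spec_norm (pinv A)) \<longrightarrow>
              sol_theta_defined \<theta> A b \<and> sol A b = sol_theta \<theta> A b)) \<and>
        (b \<notin> range (\<lambda>x. A *v x) \<longrightarrow>
           (\<forall>\<theta>. 0 < \<theta> \<and>
              \<theta> < min (inverse (spec_norm (pinv A))) (norm (b - (A ** pinv A) *v b)) \<longrightarrow>
              sol_theta_defined \<theta> A b \<and> sol A b = sol_theta \<theta> A b)))
     \<and>
     (\<forall>\<theta>>0. sol_theta_defined \<theta> A b \<longrightarrow>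
        (\<exists>\<xi>>0. \<exists>\<delta>>0. \<forall>\<Delta>A \<Delta>b. pair_norm \<Delta>A \<Delta>b < \<delta> \<longrightarrow>
           sol_theta_defined \<theta> (A + \<Delta>A) (b + \<Delta>b) \<and>
           aff_dist_le (sol_theta \<theta> (A + \<Delta>A) (b + \<Delta>b)) (sol_theta \<theta> A b)
             (\<xi> * pair_norm \<Delta>A \<Delta>b)))
     \<and>
     (A \<noteq> 0 \<and> b \<in> range (\<lambda>x. A *v x) \<longrightarrow>
        (let xs = pinv A *v b;
             \<omega> = sqrt (4 * (spec_norm (pinv A))\<^sup>2 * (norm b)\<^sup>2 + 2)
         in \<forall>\<Delta>A \<Delta>b \<theta>.
              pair_norm \<Delta>A \<Delta>b < inverse ((\<omega> + 1) * spec_norm (pinv A)) \<and>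
              \<omega> * pair_norm \<Delta>A \<Delta>b < \<theta> \<and>
              \<theta> < inverse (spec_norm (pinv A)) - pair_norm \<Delta>A \<Delta>b \<longrightarrow>
              sol_theta_defined \<theta> (A + \<Delta>A) (b + \<Delta>b) \<and>
              backward_error \<theta> (A + \<Delta>A) (b + \<Delta>b) \<le> \<omega> * pair_norm \<Delta>A \<Delta>b \<and>
              aff_dist_le (sol_theta \<theta> (A + \<Delta>A) (b + \<Delta>b)) (sol A b)
                (spec_norm A * spec_norm (pinv A) *
                 (sqrt (4 * (norm xs)\<^sup>2 + 1) /
                  (spec_norm A - spec_norm A * spec_norm (pinv A) * spec_norm \<Delta>A)) *
                 pair_norm \<Delta>A \<Delta>b)))
     \<and>
     (A \<noteq> 0 \<and> sol A b = {} \<longrightarrow>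
        (\<forall>\<theta>. 0 < \<theta> \<and>
           \<theta> < min (inverse (spec_norm (pinv A)) / 2) (norm (b - (A ** pinv A) *v b)) \<longrightarrow>
           (\<exists>\<rho>. 0 < \<rho> \<and> \<rho> < \<theta> \<and>
              (\<forall>A' b'. pair_norm (A' - A) (b' - b) < \<rho> \<longrightarrow>
                 sol_theta_defined \<theta> A' b' \<and>
                 sol_theta \<theta> A' b' = sol A b \<and> sol A b = {}))))"
proof (intro conjI impI allI)
  fix \<theta> :: real
  assume "A \<noteq> 0" "b \<in> range (\<lambda>x. A *v x)" "0 < \<theta> \<and> \<theta> < inverse (spec_norm (pinv A))"
  then show "sol_theta_defined \<theta> A b" "sol A b = sol_theta \<theta> A b"
    using sol_theta_exact by blast+
next
  fix \<theta> :: real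
  assume "A \<noteq> 0" "b \<notin> range (\<lambda>x. A *v x)"
    "0 < \<theta> \<and> \<theta> < min (inverse (spec_norm (pinv A))) (norm (b - (A ** pinv A) *v b))"
  then show "sol_theta_defined \<theta> A b" "sol A b = sol_theta \<theta> A b"
    using sol_theta_exact[of A \<theta> b] by auto
next
  fix \<theta> :: real
  assume "sol_theta_defined \<theta> A b"
  then show "\<exists>\<xi>>0. \<exists>\<delta>>0. \<forall>\<Delta>A \<Delta>b. pair_norm \<Delta>A \<Delta>b < \<delta> \<longrightarrow>
      sol_theta_defined \<theta> (A + \<Delta>A) (b + \<Delta>b) \<and>
      aff_dist_le (sol_theta \<theta> (A + \<Delta>A) (b + \<Delta>b)) (sol_theta \<theta> A b) (\<xi> * pair_norm \<Delta>A \<Delta>b)"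
    by (rule sol_theta_lipschitz)
next
  assume "A \<noteq> 0 \<and> b \<in> range (\<lambda>x. A *v x)"
  then show "let xs = pinv A *v b;
             \<omega> = sqrt (4 * (spec_norm (pinv A))\<^sup>2 * (norm b)\<^sup>2 + 2)
         in \<forall>\<Delta>A \<Delta>b \<theta>.
              pair_norm \<Delta>A \<Delta>b < inverse ((\<omega> + 1) * spec_norm (pinv A)) \<and>
              \<omega> * pair_norm \<Delta>A \<Delta>b < \<theta> \<and>
              \<theta> < inverse (spec_norm (pinv A)) - pair_norm \<Delta>A \<Delta>b \<longrightarrow>
              sol_theta_defined \<theta> (A + \<Delta>A) (b + \<Delta>b) \<and>
              backward_error \<theta> (A + \<Delta>A) (b + \<Delta>b) \<le> \<omega> * pair_norm \<Delta>A \<Delta>b \<and>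
              aff_dist_le (sol_theta \<theta> (A + \<Delta>A) (b + \<Delta>b)) (sol A b)
                (spec_norm A * spec_norm (pinv A) *
                 (sqrt (4 * (norm xs)\<^sup>2 + 1) /
                  (spec_norm A - spec_norm A * spec_norm (pinv A) * spec_norm \<Delta>A)) *
                 pair_norm \<Delta>A \<Delta>b)"
    unfolding Let_def using sol_theta_consistent[of A b] by blast
next
  fix \<theta> :: real
  assume A: "A \<noteq> 0 \<and> sol A b = {}"
    and \<theta>: "0 < \<theta> \<and> \<theta> < min (inverse (spec_norm (pinv A)) / 2) (norm (b - (A ** pinv A) *v b))"
  have empty: "sol A b = {}" using A by blast
  have exact: "sol_theta_defined \<theta> A b" "sol_theta \<theta> A b = {}"
    using sol_theta_exact[of A \<theta> b] A \<theta> by auto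
  then obtain \<xi> \<delta> where \<delta>: "0 < \<delta>" "\<And>\<Delta>A \<Delta>b. pair_norm \<Delta>A \<Delta>b < \<delta> \<Longrightarrow>
      sol_theta_defined \<theta> (A + \<Delta>A) (b + \<Delta>b) \<and>
      aff_dist_le (sol_theta \<theta> (A + \<Delta>A) (b + \<Delta>b)) {} (\<xi> * pair_norm \<Delta>A \<Delta>b)"
    using sol_theta_lipschitz[OF exact(1)] unfolding exact(2) by blast
  have "sol_theta_defined \<theta> A' b' \<and> sol_theta \<theta> A' b' = sol A b \<and> sol A b = {}"
    if "pair_norm (A' - A) (b' - b) < min \<delta> (\<theta> / 2)" for A' b'
    using \<delta>(2)[of "A' - A" "b' - b"] that by (simp add: empty aff_dist_le_empty_iff)
  moreover have "0 < min \<delta> (\<theta> / 2)" "min \<delta> (\<theta> / 2) < \<theta>" using \<delta>(1) \<theta> by auto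
  ultimately show "\<exists>\<rho>. 0 < \<rho> \<and> \<rho> < \<theta> \<and>
      (\<forall>A' b'. pair_norm (A' - A) (b' - b) < \<rho> \<longrightarrow>
         sol_theta_defined \<theta> A' b' \<and> sol_theta \<theta> A' b' = sol A b \<and> sol A b = {})"
    by blast
qed

end
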